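(* Let $m\in\mathbb Z$, $m\neq0$, and let $(\overline{\mathcal{HV}},\varphi,\Delta_r)$ be the coboundary triangular Lie bialgebra related to the solution of CYBE $r=(x,0)\otimes(x^{m+1},0)-(x^{m+1},0)\otimes(x,0)$. Then the dual Lie bialgebra of $(\overline{\mathcal{HV}},\varphi,\Delta_r)$ is $(\overline{\mathcal{HV}}{}^{\circ},[\cdot,\cdot],\Delta)$, where $\overline{\mathcal{HV}}{}^\circ=\mathcal A^\circ\oplus\mathcal A^\circ$, the cobracket $\Delta$ is determined by $$\Delta\big((\varepsilon^p,0)\big)=\sum_{i+j=p+1}(j-i)(\varepsilon^i,0)\otimes(\varepsilon^j,0),\qquad \Delta\big((0,\varepsilon^p)\big)=\sum_{i+j=p+1}\big(j(\varepsilon^i,0)\otimes(0,\varepsilon^j)-i(0,\varepsilon^i)\otimes(\varepsilon^j,0)\big)\quad(p\in\mathbb Z),$$ and the bracket is uniquely determined by (for $i,j\in\mathbb Z$): (1) $[(\varepsilon^i,0),(\varepsilon^j,0)]=\begin{cases}(2m-j+1)(\varepsilon^{j-m},0)&\text{if } i=1,\ j\neq1,\\ (j-1)(\varepsilon^j,0)&\text{if } i=m+1,\ j\neq1,m+1,\\ 0&\text{if } i,j\notin\{1,m+1\};\end{cases}$ (2) $[(\varepsilon^i,0),(0,\varepsilon^j)]=\begin{cases}(m-j)(0,\varepsilon^{j-m})&\text{if } i=1,\\ j(0,\varepsilon^j)&\text{if } i=m+1,\\ 0&\text{if } i\notin\{1,m+1\};\end{cases}$ (3) $[(0,\varepsi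lon^i),(0,\varepsilon^j)]=0$.
   Context: $\mathcal K$ is an algebraically closed field of characteristic zero, $\mathcal A=\mathcal K[x^{\pm1}]$, $\partial=\frac{d}{dx}$. $\overline{\mathcal{HV}}=\mathcal A\oplus\mathcal A$ is the centerless twisted Heisenberg-Virasoro algebra with Lie bracket $\varphi=[\cdot,\cdot]$, $[(f_1,f_2),(g_1,g_2)]=(f_1\partial g_1-g_1\partial f_1,\ f_1\partial g_2-g_1\partial f_2)$; with $L_m=(x^{m+1},0)$, $I_n=(0,x^n)$ this reads $[L_m,L_n]=(n-m)L_{m+n}$, $[I_m,I_n]=0$, $[L_m,I_n]=nI_{m+n}$. Lie bialgebra: a Lie algebra with a Lie cobracket $\delta$ such that $\delta[x,y]=x\cdot\delta(y)-y\cdot\delta(x)$, where $x\cdot(y\otimes z)=[x,y]\otimes z+y\otimes[x,z]$. For $r\in\overline{\mathcal{HV}}\otimes\overline{\mathcal{HV}}$, $\Delta_r(z)=z\cdot r$; the bialgebra is coboundary triangular if its cobracket is $\Delta_r$ with $r$ satisfying the classical Yang-Baxter equation (CYBE) $[r_{12},r_{13}]+[r_{12},r_{23}]+[r_{13},r_{23}]=0$. $\varphi^*:\overline{\mathcal{HV}}{}^*\to(\overline{\mathcal{HV}}\otimes\overline{\mathcal{HV}})^*$ is the dual of the bracket; $\overline{\mathcal{HV}}{}^{\circ}$ is the maximal good subspace of $\overline{\mathcal{HV}}{}^*$, i.e. the sum of all subspaces $U$ with $\varphi^*(U)\subset U\otimes U$. It equals $\mathcal A^\circ\oplus\mathcal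 A^\circ$ with $\mathcal A^\circ=\{\sum_{i\in\mathbb Z}f_i\varepsilon^i\in\mathcal A^*\mid \exists\, r\in\mathbb N,\ c_1,\dots,c_r\in\mathcal K:\ f_n=\sum_{j=1}^r c_jf_{n-j}\ \forall n\in\mathbb Z\}$. The dual Lie bialgebra of a Lie bialgebra $(\overline{\mathcal{HV}},\varphi,\delta)$ is $\overline{\mathcal{HV}}{}^\circ$ with bracket and cobracket dual to $\delta$ and $\varphi$: $\langle[f,h],\xi\rangle=\langle f\otimes h,\delta(\xi)\rangle$ and $\langle\Delta f,\xi\otimes\eta\rangle=\langle f,[\xi,\eta]\rangle$ for $f,h\in\overline{\mathcal{HV}}{}^\circ$, $\xi,\eta\in\overline{\mathcal{HV}}$. $\varepsilon^i\in\mathcal A^*$ is given by $\varepsilon^i(x^j)=\delta_{i,j}$; every $f\in\mathcal A^*$ is written as a formal (possibly infinite) sum $\sum_j f_j\varepsilon^j$, $f_j=f(x^j)$. $(\varepsilon^i,0)(x^k,x^l)=\delta_{i,k}$, $(0,\varepsilon^i)(x^k,x^l)=\delta_{i,l}$. Infinite sums denote functionals evaluated termwise; the formulas on the $\varepsilon^i$ are formulas for the dual maps $\varphi^*$ and $(f,h)\mapsto(f\otimes h)\circ\delta$ on these functionals, and the structure on $\overline{\mathcal{HV}}{}^\circ$ is obtained by extending them to formal infinite linear combinations (remaining brackets following from skew-symmetry). *)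

theory Defs
  imports
    "HOL-Computational_Algebra.Polynomial"
    "HOL-Library.Poly_Mapping"
    "HOL-Library.Function_Algebras"
    "HOL-Library.Product_Plus"
begin

section \<open>Multilinear maps and tensors\<close>

text \<open>Vector spaces are given by a scalar multiplication \<open>s\<close> on an abelian group type together
  with a carrier subspace \<open>V\<close>. Spaces of scalar-valued functions carry the pointwise structure.\<close>

definition fun_scale :: "'k::field \<Rightarrow> ('a \<Rightarrow> 'k) \<Rightarrow> 'a \<Rightarrow> 'k"
  where "fun_scale c f = (\<lambda>x. c * f x)"

definition linear_on ::
  "('k::field \<Rightarrow> 'v::ab_group_add \<Rightarrow> 'v) \<Rightarrow> ('k \<Rightarrow> 'w::ab_group_add \<Rightarrow> 'w) \<Rightarrow> 'v set \<Rightarrow> ('v \<Rightarrow> 'w) \<Rightarrow> bool"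
  where "linear_on s t V F \<longleftrightarrow>
    (\<forall>x\<in>V. \<forall>y\<in>V. F (x + y) = F x + F y) \<and> (\<forall>c. \<forall>x\<in>V. F (s c x) = t c (F x))"

definition bilinear_on ::
  "('k::field \<Rightarrow> 'v::ab_group_add \<Rightarrow> 'v) \<Rightarrow> ('k \<Rightarrow> 'w::ab_group_add \<Rightarrow> 'w) \<Rightarrow> 'v set \<Rightarrow> ('v \<Rightarrow> 'v \<Rightarrow> 'w) \<Rightarrow> bool"
  where "bilinear_on s t V B \<longleftrightarrow>
    (\<forall>x\<in>V. linear_on s t V (\<lambda>y. B x y)) \<and> (\<forall>y\<in>V. linear_on s t V (\<lambda>x. B x y))"

definition trilinear_on ::
  "('k::field \<Rightarrow> 'v::ab_group_add \<Rightarrow> 'v) \<Rightarrow> ('k \<Rightarrow> 'w::ab_group_add \<Rightarrow> 'w) \<Rightarrow> 'v set \<Rightarrow> ('v \<Rightarrow> 'v \<Rightarrow> 'v \<Rightarrow> 'w) \<Rightarrow> bool"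
  where "trilinear_on s t V T \<longleftrightarrow>
    (\<forall>x\<in>V. bilinear_on s t V (\<lambda>y z. T x y z)) \<and> (\<forall>y\<in>V. \<forall>z\<in>V. linear_on s t V (\<lambda>x. T x y z))"

abbreviation bilinear_form_on ::
  "('k::field \<Rightarrow> 'v::ab_group_add \<Rightarrow> 'v) \<Rightarrow> 'v set \<Rightarrow> ('v \<Rightarrow> 'v \<Rightarrow> 'k) \<Rightarrow> bool"
  where "bilinear_form_on s V \<equiv> bilinear_on s (*) V"

abbreviation trilinear_form_on ::
  "('k::field \<Rightarrow> 'v::ab_group_add \<Rightarrow> 'v) \<Rightarrow> 'v set \<Rightarrow> ('v \<Rightarrow> 'v \<Rightarrow> 'v \<Rightarrow> 'k) \<Rightarrow> bool"
  where "trilinear_form_on s V \<equiv> trilinear_on s (*) V"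

text \<open>Over a field, \<open>V \<otimes> V\<close> embeds canonically into the dual of the space of bilinear forms on \<open>V\<close>
  by \<open>v \<otimes> w \<mapsto> (B \<mapsto> B v w)\<close>; this image is what is used here as \<open>V \<otimes> V\<close>. Hence for
  \<open>T = (\<Sum>i. v\<^sub>i \<otimes> w\<^sub>i)\<close> and a bilinear form \<open>B\<close> the value \<open>T B\<close> is \<open>\<Sum>i. B v\<^sub>i w\<^sub>i\<close>, i.e. the value at
  \<open>T\<close> of the linear form on \<open>V \<otimes> V\<close> induced by \<open>B\<close>. Tensors are set to \<open>0\<close> off the bilinear forms,
  so that equal tensors are equal as functions.\<close>

type_synonym ('k, 'v) tensor = "('v \<Rightarrow> 'v \<Rightarrow> 'k) \<Rightarrow> 'k"

definition tens ::
  "('k::field \<Rightarrow> 'v::ab_group_add \<Rightarrow> 'v) \<Rightarrow> 'v set \<Rightarrow> 'v \<Rightarrow> 'v \<Rightarrow> ('k, 'v) tensor"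
  where "tens s V v w = (\<lambda>B. if bilinear_form_on s V B then B v w else 0)"

definition tensor_square ::
  "('k::field \<Rightarrow> 'v::ab_group_add \<Rightarrow> 'v) \<Rightarrow> 'v set \<Rightarrow> ('k, 'v) tensor set"
  where "tensor_square s V = module.span fun_scale {tens s V v w | v w. v \<in> V \<and> w \<in> V}"

text \<open>\<open>x \<cdot> (v \<otimes> w) = [x,v] \<otimes> w + v \<otimes> [x,w]\<close>, see \<open>act_tens\<close> below.\<close>

definition act ::
  "('k::field \<Rightarrow> 'v::ab_group_add \<Rightarrow> 'v) \<Rightarrow> 'v set \<Rightarrow> ('v \<Rightarrow> 'v \<Rightarrow> 'v) \<Rightarrow> 'v \<Rightarrow> ('k, 'v) tensor \<Rightarrow> ('k, 'v) tensor"
  where "act s V br x T =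
    (\<lambda>B. if bilinear_form_on s V B then T (\<lambda>v w. B (br x v) w + B v (br x w)) else 0)"

section \<open>Lie bialgebras\<close>

definition lie_algebra_on ::
  "('k::field \<Rightarrow> 'v::ab_group_add \<Rightarrow> 'v) \<Rightarrow> 'v set \<Rightarrow> ('v \<Rightarrow> 'v \<Rightarrow> 'v) \<Rightarrow> bool"
  where "lie_algebra_on s V br \<longleftrightarrow>
    vector_space s \<and> module.subspace s V \<and>
    (\<forall>x\<in>V. \<forall>y\<in>V. br x y \<in> V) \<and>
    bilinear_on s s V br \<and>
    (\<forall>x\<in>V. br x x = 0) \<and>
    (\<forall>x\<in>V. \<forall>y\<in>V. \<forall>z\<in>V. br x (br y z) + br y (br z x) + br z (br x y) = 0)"

text \<open>The last two clauses are antisymmetry of \<open>\<delta>\<close> and the co-Jacobi identity, the vanishing of the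
  sum of the three cyclic permutations of \<open>(id \<otimes> \<delta>) \<delta> x\<close>, tested against all trilinear forms.\<close>

definition lie_cobracket_on ::
  "('k::field \<Rightarrow> 'v::ab_group_add \<Rightarrow> 'v) \<Rightarrow> 'v set \<Rightarrow> ('v \<Rightarrow> ('k, 'v) tensor) \<Rightarrow> bool"
  where "lie_cobracket_on s V \<delta> \<longleftrightarrow>
    (\<forall>x\<in>V. \<delta> x \<in> tensor_square s V) \<and>
    linear_on s fun_scale V \<delta> \<and>
    (\<forall>x\<in>V. \<forall>B. bilinear_form_on s V B \<longrightarrow> \<delta> x (\<lambda>v w. B w v) = - \<delta> x B) \<and>
    (\<forall>x\<in>V. \<forall>T. trilinear_form_on s V T \<longrightarrow>
        \<delta> x (\<lambda>u v. \<delta> v (\<lambda>a b. T u a b))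
      + \<delta> x (\<lambda>u v. \<delta> v (\<lambda>a b. T a b u))
      + \<delta> x (\<lambda>u v. \<delta> v (\<lambda>a b. T b u a)) = 0)"

definition lie_bialgebra_on ::
  "('k::field \<Rightarrow> 'v::ab_group_add \<Rightarrow> 'v) \<Rightarrow> 'v set \<Rightarrow> ('v \<Rightarrow> 'v \<Rightarrow> 'v) \<Rightarrow> ('v \<Rightarrow> ('k, 'v) tensor) \<Rightarrow> bool"
  where "lie_bialgebra_on s V br \<delta> \<longleftrightarrow>
    lie_algebra_on s V br \<and> lie_cobracket_on s V \<delta> \<and>
    (\<forall>x\<in>V. \<forall>y\<in>V. \<delta> (br x y) = act s V br x (\<delta> y) - act s V br y (\<delta> x))"

text \<open>\<open>[r\<^sub>1\<^sub>2,r\<^sub>1\<^sub>3] + [r\<^sub>1\<^sub>2,r\<^sub>2\<^sub>3] + [r\<^sub>1\<^sub>3,r\<^sub>2\<^sub>3] = 0\<close> in \<open>V \<otimes> V \<otimes> V\<close>, tested against all trilinear forms;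
  \<open>a \<otimes> b\<close> runs through the first and \<open>c \<otimes> d\<close> through the second factor of each bracket.\<close>

definition cybe ::
  "('k::field \<Rightarrow> 'v::ab_group_add \<Rightarrow> 'v) \<Rightarrow> 'v set \<Rightarrow> ('v \<Rightarrow> 'v \<Rightarrow> 'v) \<Rightarrow> ('k, 'v) tensor \<Rightarrow> bool"
  where "cybe s V br r \<longleftrightarrow> (\<forall>T. trilinear_form_on s V T \<longrightarrow>
      r (\<lambda>a b. r (\<lambda>c d. T (br a c) b d))
    + r (\<lambda>a b. r (\<lambda>c d. T a (br b c) d))
    + r (\<lambda>a b. r (\<lambda>c d. T a c (br b d))) = 0)"

definition coboundary ::
  "('k::field \<Rightarrow> 'v::ab_group_add \<Rightarrow> 'v) \<Rightarrow> 'v set \<Rightarrow> ('v \<Rightarrow> 'v \<Rightarrow> 'v) \<Rightarrow> ('k, 'v) tensor \<Rightarrow> 'v \<Rightarrow> ('k, 'v) tensor"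
  where "coboundary s V br r = (\<lambda>z. act s V br z r)"

definition coboundary_triangular ::
  "('k::field \<Rightarrow> 'v::ab_group_add \<Rightarrow> 'v) \<Rightarrow> 'v set \<Rightarrow> ('v \<Rightarrow> 'v \<Rightarrow> 'v) \<Rightarrow> ('k, 'v) tensor \<Rightarrow> bool"
  where "coboundary_triangular s V br r \<longleftrightarrow>
    r \<in> tensor_square s V \<and> cybe s V br r \<and> lie_bialgebra_on s V br (coboundary s V br r)"

section \<open>Dual Lie bialgebras\<close>

text \<open>Here the primal vector space is a whole type. Linear forms on \<open>V \<otimes> V\<close> are identified with
  bilinear forms on \<open>V\<close>, so that \<open>\<phi>\<^sup>*\<close> sends \<open>f\<close> to \<open>(\<xi>, \<eta>) \<mapsto> f [\<xi>, \<eta>]\<close>.\<close>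

definition dual_space :: "('k::field \<Rightarrow> 'v::ab_group_add \<Rightarrow> 'v) \<Rightarrow> ('v \<Rightarrow> 'k) set"
  where "dual_space s = {f. Vector_Spaces.linear s (*) f}"

definition form_tens :: "('v \<Rightarrow> 'k) \<Rightarrow> ('v \<Rightarrow> 'k) \<Rightarrow> 'v \<Rightarrow> 'v \<Rightarrow> 'k::field"
  where "form_tens f h = (\<lambda>\<xi> \<eta>. f \<xi> * h \<eta>)"

definition dual_cobracket :: "('v \<Rightarrow> 'v \<Rightarrow> 'v) \<Rightarrow> ('v \<Rightarrow> 'k::field) \<Rightarrow> 'v \<Rightarrow> 'v \<Rightarrow> 'k"
  where "dual_cobracket br f = (\<lambda>\<xi> \<eta>. f (br \<xi> \<eta>))"

definition dual_bracket ::
  "('v \<Rightarrow> ('k::field, 'v) tensor) \<Rightarrow> ('v \<Rightarrow> 'k) \<Rightarrow> ('v \<Rightarrow> 'k) \<Rightarrow> 'v \<Rightarrow> 'k"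
  where "dual_bracket \<delta> f h = (\<lambda>\<xi>. \<delta> \<xi> (form_tens f h))"

text \<open>Curried bilinear forms are functions into functions, hence the nested pointwise scaling.
  The maximal good subspace is the sum, i.e. the span of the union, of all good subspaces.\<close>

definition good_subspace ::
  "('k::field \<Rightarrow> 'v::ab_group_add \<Rightarrow> 'v) \<Rightarrow> ('v \<Rightarrow> 'v \<Rightarrow> 'v) \<Rightarrow> ('v \<Rightarrow> 'k) set \<Rightarrow> bool"
  where "good_subspace s br U \<longleftrightarrow>
    U \<subseteq> dual_space s \<and> module.subspace fun_scale U \<and>
    dual_cobracket br ` U \<subseteq>
      module.span (\<lambda>c F x. fun_scale c (F x)) {form_tens f h | f h. f \<in> U \<and> h \<in> U}"

definition maximal_good ::
  "('k::field \<Rightarrow> 'v::ab_group_add \<Rightarrow> 'v) \<Rightarrow> ('v \<Rightarrow> 'v \<Rightarrow> 'v) \<Rightarrow> ('v \<Rightarrow> 'k) set"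
  where "maximal_good s br = module.span fun_scale (\<Union>{U. good_subspace s br U})"

text \<open>The linear form on \<open>V \<otimes> V\<close> given by a tensor of linear forms on \<open>V\<close>.\<close>

definition form_of_tensor :: "('k::field, 'v \<Rightarrow> 'k) tensor \<Rightarrow> 'v \<Rightarrow> 'v \<Rightarrow> 'k"
  where "form_of_tensor T = (\<lambda>\<xi> \<eta>. T (\<lambda>f h. f \<xi> * h \<eta>))"

definition dual_lie_bialgebra ::
  "('k::field \<Rightarrow> 'v::ab_group_add \<Rightarrow> 'v) \<Rightarrow> ('v \<Rightarrow> 'v \<Rightarrow> 'v) \<Rightarrow> ('v \<Rightarrow> ('k, 'v) tensor) \<Rightarrow>
   ('v \<Rightarrow> 'k) set \<Rightarrow> (('v \<Rightarrow> 'k) \<Rightarrow> ('v \<Rightarrow> 'k) \<Rightarrow> ('v \<Rightarrow> 'k)) \<Rightarrow> (('v \<Rightarrow> 'k) \<Rightarrow> ('k, 'v \<Rightarrow> 'k) tensor) \<Rightarrow> bool"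
  where "dual_lie_bialgebra s br \<delta> V b D \<longleftrightarrow>
    V = maximal_good s br \<and>
    lie_bialgebra_on fun_scale V b D \<and>
    (\<forall>f\<in>V. \<forall>h\<in>V. b f h = dual_bracket \<delta> f h) \<and>
    (\<forall>f\<in>V. form_of_tensor (D f) = dual_cobracket br f)"

section \<open>The centerless twisted Heisenberg-Virasoro algebra\<close>

type_synonym 'k laurent = "int \<Rightarrow>\<^sub>0 'k"
type_synonym 'k hv = "'k laurent \<times> 'k laurent"

definition xpow :: "int \<Rightarrow> 'k::field laurent"
  where "xpow n = Poly_Mapping.single n 1"

definition laurent_scale :: "'k::field \<Rightarrow> 'k laurent \<Rightarrow> 'k laurent"
  where "laurent_scale c f = Poly_Mapping.map ((*) c) f"

definition laurent_deriv :: "'k::field laurent \<Rightarrow> 'k laurent"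
  where "laurent_deriv f =
    (\<Sum>k\<in>Poly_Mapping.keys f. Poly_Mapping.single (k - 1) (of_int k * Poly_Mapping.lookup f k))"

definition hv_scale :: "'k::field \<Rightarrow> 'k hv \<Rightarrow> 'k hv"
  where "hv_scale c v = (laurent_scale c (fst v), laurent_scale c (snd v))"

definition hv_bracket :: "'k::field hv \<Rightarrow> 'k hv \<Rightarrow> 'k hv"
  where "hv_bracket v w =
    (fst v * laurent_deriv (fst w) - fst w * laurent_deriv (fst v),
     fst v * laurent_deriv (snd w) - fst w * laurent_deriv (snd v))"

abbreviation hv_tens :: "'k::field hv \<Rightarrow> 'k hv \<Rightarrow> ('k, 'k hv) tensor"
  where "hv_tens \<equiv> tens hv_scale UNIV"

text \<open>Indices \<open>Inl i\<close> and \<open>Inr i\<close> refer to the first and second copy of the Laurent polynomials: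
  \<open>eps (Inl i) = (\<epsilon>\<^sup>i, 0)\<close> and \<open>eps (Inr i) = (0, \<epsilon>\<^sup>i)\<close>.\<close>

fun hv_basis :: "int + int \<Rightarrow> 'k::field hv"
  where
    "hv_basis (Inl i) = (xpow i, 0)"
  | "hv_basis (Inr i) = (0, xpow i)"

fun eps :: "int + int \<Rightarrow> 'k::field hv \<Rightarrow> 'k"
  where
    "eps (Inl i) = (\<lambda>v. Poly_Mapping.lookup (fst v) i)"
  | "eps (Inr i) = (\<lambda>v. Poly_Mapping.lookup (snd v) i)"

abbreviation eps1 :: "int \<Rightarrow> 'k::field hv \<Rightarrow> 'k" where "eps1 i \<equiv> eps (Inl i)"
abbreviation eps2 :: "int \<Rightarrow> 'k::field hv \<Rightarrow> 'k" where "eps2 i \<equiv> eps (Inr i)"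

definition laurent_circ :: "('k::field laurent \<Rightarrow> 'k) set"
  where "laurent_circ = {f \<in> dual_space laurent_scale.
    \<exists>(r::nat) (c::nat \<Rightarrow> 'k). \<forall>n. f (xpow n) = (\<Sum>j=1..r. c j * f (xpow (n - int j)))}"

definition laurent_circ_sum :: "('k::field hv \<Rightarrow> 'k) set"
  where "laurent_circ_sum =
    {(\<lambda>v. f (fst v) + g (snd v)) | f g. f \<in> laurent_circ \<and> g \<in> laurent_circ}"

section \<open>Formal infinite linear combinations\<close>

text \<open>\<open>termwise_sum S t F\<close> says that \<open>F\<close> is the formal sum of the \<open>t i\<close>, \<open>i \<in> S\<close>: at every argument
  only finitely many terms are nonzero, and they add up to the value of \<open>F\<close>.\<close>

definition termwise_sum :: "'i set \<Rightarrow> ('i \<Rightarrow> 'a \<Rightarrow> 'k::comm_monoid_add) \<Rightarrow> ('a \<Rightarrow> 'k) \<Rightarrow> bool"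
  where "termwise_sum S t F \<longleftrightarrow>
    (\<forall>x. finite {i \<in> S. t i x \<noteq> 0} \<and> F x = (\<Sum>i | i \<in> S \<and> t i x \<noteq> 0. t i x))"

definition termwise_sum2 :: "'i set \<Rightarrow> ('i \<Rightarrow> 'a \<Rightarrow> 'b \<Rightarrow> 'k::comm_monoid_add) \<Rightarrow> ('a \<Rightarrow> 'b \<Rightarrow> 'k) \<Rightarrow> bool"
  where "termwise_sum2 S t F \<longleftrightarrow> (\<forall>x. termwise_sum S (\<lambda>i. t i x) (F x))"

text \<open>Compatibility with \<open>f = (\<Sum>a. f\<^sub>a \<epsilon>\<^sup>a)\<close>, where \<open>f\<^sub>a = f (hv_basis a)\<close>.\<close>

definition formally_bilinear ::
  "(('k::field hv \<Rightarrow> 'k) \<Rightarrow> ('k hv \<Rightarrow> 'k) \<Rightarrow> ('k hv \<Rightarrow> 'k)) \<Rightarrow> bool"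
  where "formally_bilinear B \<longleftrightarrow> (\<forall>f\<in>dual_space hv_scale. \<forall>h\<in>dual_space hv_scale.
    termwise_sum UNIV
      (\<lambda>(a, b) \<xi>. f (hv_basis a) * h (hv_basis b) * B (eps a) (eps b) \<xi>) (B f h))"

definition formally_linear ::
  "(('k::field hv \<Rightarrow> 'k) \<Rightarrow> 'k hv \<Rightarrow> 'k hv \<Rightarrow> 'k) \<Rightarrow> bool"
  where "formally_linear C \<longleftrightarrow> (\<forall>f\<in>dual_space hv_scale.
    termwise_sum2 UNIV (\<lambda>a \<xi> \<eta>. f (hv_basis a) * C (eps a) \<xi> \<eta>) (C f))"

section \<open>Basic facts\<close>

lemma act_tens:
  assumes "lie_algebra_on s V br" "x \<in> V" "v \<in> V" "w \<in> V"
  shows "act s V br x (tens s V v w) = tens s V (br x v) w + tens s V v (br x w)"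
proof -
  have "bilinear_form_on s V (\<lambda>v w. B (br x v) w + B v (br x w))"
    if B: "bilinear_form_on s V B" for B
  proof -
    have cl: "\<And>y. y \<in> V \<Longrightarrow> br x y \<in> V"
      and add: "\<And>y z. y \<in> V \<Longrightarrow> z \<in> V \<Longrightarrow> br x (y + z) = br x y + br x z"
      and scl: "\<And>c y. y \<in> V \<Longrightarrow> br x (s c y) = s c (br x y)"
      using assms by (auto simp: lie_algebra_on_def bilinear_on_def linear_on_def)
    show ?thesis
      using B cl add scl unfolding bilinear_on_def linear_on_def
      by (auto simp: algebra_simps)
  qed
  then show ?thesis
    by (auto simp: act_def tens_def fun_eq_iff)
qed

lemma laurent_deriv_single [simp]:
  "laurent_deriv (Poly_Mapping.single k c) = Poly_Mapping.single (k - 1) (of_int k * c)"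
  by (cases "c = 0") (simp_all add: laurent_deriv_def)

lemma hv_bracket_LL:
  "hv_bracket (xpow (m + 1), 0) (xpow (n + 1), 0) = hv_scale (of_int (n - m)) (xpow (m + n + 1), 0)"
proof -
  have "Poly_Mapping.map ((*) c) (Poly_Mapping.single k 1) = Poly_Mapping.single k c"
    for c :: 'a and k :: int
    by (rule poly_mapping_eqI) (simp add: map.rep_eq lookup_single when_def)
  then show ?thesis
    by (simp add: hv_bracket_def hv_scale_def xpow_def laurent_scale_def laurent_deriv_def
        mult_single single_diff [symmetric] algebra_simps map_eq_zero_iff)
qed

lemma eps_hv_basis: "eps a (hv_basis b) = (if a = b then 1 else 0)"
  by (cases a; cases b) (auto simp: xpow_def lookup_single when_def)

end

theory Submission
  imports Defs
begin

text \<open>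
  \<^emph>\<open>The bialgebra.\<close> Put \<open>a = (x, 0)\<close> and \<open>b = (x\<^bsup>m+1\<^esup>, 0)\<close>. Then \<open>[a, b] = m b\<close>, and in any Lie algebra such a
  pair gives a triangular structure with \<open>r = a \<otimes> b - b \<otimes> a\<close>: the Yang-Baxter equation is
  a direct computation, and the co-Jacobi identity reduces to the Jacobi identity (\<open>wedge_coboundary_triangular\<close>).

  \<^emph>\<open>Dualization.\<close> If \<open>V\<close> is a good subspace that is stable under the bracket dual to \<open>\<delta>\<close>, then \<open>V\<close> is a
  Lie bialgebra (\<open>dual_lie_bialgebra_exists\<close>). The identities required of the cobracket of \<open>V\<close> are
  equations in \<open>V \<otimes> V\<close> or \<open>V \<otimes> V \<otimes> V\<close>, tested against all multilinear forms on \<open>V\<close>. In a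
  finite-dimensional space of functions there is a finite set of points with a dual basis of
  functions (\<open>interpolation_points\<close>), so that every linear form is a combination of point
  evaluations. Hence it suffices to test against evaluations, where each identity becomes one of
  the given Lie bialgebra. For a bracket dual to a coboundary, stability holds since good
  subspaces are stable under the coadjoint action (\<open>good_subspace_coadjoint\<close>).

  \<^emph>\<open>The maximal good subspace.\<close> A functional on the Laurent polynomials is linearly recursive iff it is
  killed by a nonzero Laurent polynomial (\<open>laurent_circ_iff\<close>). The multiples \<open>p \<cdot> f\<close> of such a
  functional \<open>f\<close> span a finite-dimensional space, so \<open>(u, w) \<mapsto> f (u w)\<close> has finite rank within the
  recursive functionals, and these are stable under the transpose of the derivation. So
  \<open>laurent_circ_sum\<close> is good. Conversely let \<open>(f, g)\<close> belong to a good subspace. Then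
  \<open>(u, w) \<mapsto> f (u w' - w u')\<close> has finite rank, and linear algebra yields nonzero \<open>u\<close> and \<open>s\<close> with
  disjoint supports that lie in the left kernel; the Wronskian \<open>u s' - s u'\<close> is nonzero and kills
  \<open>f\<close> (\<open>witt_finite_rank_laurent_circ\<close>). Likewise \<open>g (u w') = 0\<close> for all \<open>u\<close> and some \<open>w\<close> with
  \<open>w' \<noteq> 0\<close>, and \<open>w'\<close> kills \<open>g\<close> (\<open>deriv_finite_rank_laurent_circ\<close>).

  \<^emph>\<open>The formulas.\<close> The dual bracket is an explicit combination of products of \<open>f\<close> and \<open>h\<close> evaluated at
  \<open>a\<close>, \<open>b\<close>, \<open>[\<xi>, a]\<close> and \<open>[\<xi>, b]\<close>, and both dual maps are compatible with formal sums because all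
  vectors have finite support. A map compatible with formal sums is determined by its values on
  the dual basis vectors, and together with skew-symmetry the listed values cover all pairs.
\<close>

section \<open>Finite sums of pure tensors\<close>

lemma vector_space_fun_scale: "vector_space (fun_scale :: 'k::field \<Rightarrow> ('a \<Rightarrow> 'k) \<Rightarrow> 'a \<Rightarrow> 'k)"
  by unfold_locales (auto simp: fun_scale_def fun_eq_iff algebra_simps)

text \<open>The prefix \<open>fs\<close> refers to spaces of functions, \<open>fs2\<close> to spaces of curried functions of two
  arguments, both with pointwise operations.\<close>

interpretation fs: vector_space "fun_scale :: 'k::field \<Rightarrow> ('a \<Rightarrow> 'k) \<Rightarrow> 'a \<Rightarrow> 'k"
  by (rule vector_space_fun_scale)

lemma vector_space_curried:
  "vector_space (\<lambda>(c::'k::field) (F :: 'a \<Rightarrow> 'b \<Rightarrow> 'k) x. fun_scale c (F x))"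
  by unfold_locales (auto simp: fun_scale_def fun_eq_iff algebra_simps)

interpretation fs2: vector_space "\<lambda>(c::'k::field) (F :: 'a \<Rightarrow> 'b \<Rightarrow> 'k) x. fun_scale c (F x)"
  by (rule vector_space_curried)

lemma fun_scale_apply [simp]: "fun_scale c f x = c * f x"
  by (simp add: fun_scale_def)

lemma linear_on_zero:
  assumes "vector_space s" "module.subspace s V" "linear_on s t V F" "vector_space t"
  shows "F 0 = 0"
proof -
  interpret vs: vector_space s by fact
  interpret vt: vector_space t by fact
  have "F (s 0 0) = t 0 (F 0)"
    using assms(3) vs.subspace_0[OF assms(2)] unfolding linear_on_def by blast
  then show ?thesis by simp
qed

lemma vector_space_mult: "vector_space ((*) :: 'k::field \<Rightarrow> 'k \<Rightarrow> 'k)"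
  by unfold_locales (auto simp: algebra_simps)

lemma linear_on_sum:
  assumes "vector_space s" "module.subspace s V" "linear_on s t V F" "vector_space t"
    "finite A" "\<And>a. a \<in> A \<Longrightarrow> g a \<in> V"
  shows "F (\<Sum>a\<in>A. g a) = (\<Sum>a\<in>A. F (g a))"
proof -
  interpret vs: vector_space s by fact
  show ?thesis using assms(5,6)
  proof (induction A rule: finite_induct)
    case empty
    show ?case using linear_on_zero[OF assms(1-4)] by simp
  next
    case (insert a A)
    have "(\<Sum>a\<in>A. g a) \<in> V"
      using insert.prems by (intro vs.subspace_sum[OF assms(2)]) auto
    then show ?case using insert assms(3) by (simp add: linear_on_def)
  qed
qed

text \<open>The sum of the pure tensors \<open>v \<otimes> w\<close>, for \<open>(v, w)\<close> in a list. Scalars can be absorbed in the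
  first factor, so that these sums already form the tensor square.\<close>

definition tensor_of ::
  "('k::field \<Rightarrow> 'v::ab_group_add \<Rightarrow> 'v) \<Rightarrow> 'v set \<Rightarrow> ('v \<times> 'v) list \<Rightarrow> ('k, 'v) tensor"
  where "tensor_of s V ps = (\<lambda>B. if bilinear_form_on s V B then \<Sum>(v, w)\<leftarrow>ps. B v w else 0)"

lemma tensor_of_apply:
  "bilinear_form_on s V B \<Longrightarrow> tensor_of s V ps B = (\<Sum>(v, w)\<leftarrow>ps. B v w)"
  by (simp add: tensor_of_def)

lemma tensor_of_append: "tensor_of s V (ps @ qs) = tensor_of s V ps + tensor_of s V qs"
  by (auto simp: tensor_of_def fun_eq_iff)

lemma tensor_of_single: "tensor_of s V [(v, w)] = tens s V v w"
  by (auto simp: tensor_of_def tens_def fun_eq_iff)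

lemma tens_scale:
  assumes "v \<in> V" "w \<in> V"
  shows "tens s V (s c v) w = fun_scale c (tens s V v w)"
  using assms by (auto simp: tens_def fun_eq_iff bilinear_on_def linear_on_def)

lemma sum_list_sum_swap: "(\<Sum>x\<leftarrow>xs. \<Sum>y\<in>A. f x y) = (\<Sum>y\<in>A. \<Sum>x\<leftarrow>xs. f x y :: 'a::comm_monoid_add)"
  by (induction xs) (auto simp: sum.distrib)

lemma tensor_square_iff:
  assumes "vector_space s" "module.subspace s V"
  shows "T \<in> tensor_square s V \<longleftrightarrow> (\<exists>ps. set ps \<subseteq> V \<times> V \<and> T = tensor_of s V ps)"
proof
  interpret vs: vector_space s by fact
  assume "T \<in> tensor_square s V"
  then show "\<exists>ps. set ps \<subseteq> V \<times> V \<and> T = tensor_of s V ps"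
    unfolding tensor_square_def
  proof (induction rule: fs.span_induct_alt)
    case base
    show ?case by (rule exI[of _ "[]"]) (auto simp: tensor_of_def fun_eq_iff)
  next
    case (step c x y)
    then obtain v w ps where "x = tens s V v w" "v \<in> V" "w \<in> V" "set ps \<subseteq> V \<times> V" "y = tensor_of s V ps"
      by auto
    then show ?case
      using vs.subspace_scale[OF assms(2)]
      by (intro exI[of _ "[(s c v, w)] @ ps"])
         (simp add: tensor_of_append tensor_of_single tens_scale del: append_Cons)
  qed
next
  assume "\<exists>ps. set ps \<subseteq> V \<times> V \<and> T = tensor_of s V ps"
  then obtain ps where ps: "set ps \<subseteq> V \<times> V" and T: "T = tensor_of s V ps" by blast
  have "tensor_of s V ps \<in> tensor_square s V" using ps
  proof (induction ps)
    case Nil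
    have "tensor_of s V [] = 0" by (auto simp: tensor_of_def fun_eq_iff)
    then show ?case by (simp only: tensor_square_def fs.span_zero)
  next
    case (Cons p ps)
    obtain v w where p: "p = (v, w)" by (cases p)
    have "tensor_of s V (p # ps) = tens s V v w + tensor_of s V ps"
      using tensor_of_append[of s V "[p]" ps] by (simp add: p tensor_of_single)
    moreover have "tens s V v w \<in> {tens s V v w | v w. v \<in> V \<and> w \<in> V}"
      using Cons.prems p by auto
    moreover have "tensor_of s V ps \<in> tensor_square s V" using Cons by simp
    ultimately show ?case unfolding tensor_square_def
      by (simp only: fs.span_add fs.span_base)
  qed
  then show "T \<in> tensor_square s V" by (simp add: T)
qed

lemma tensor_square_off: "T \<in> tensor_square s V \<Longrightarrow> \<not> bilinear_form_on s V B \<Longrightarrow> T B = 0"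
  unfolding tensor_square_def
  by (induction rule: fs.span_induct_alt) (auto simp: tens_def)

lemma bilinear_form_on_add:
  assumes "bilinear_form_on s V A" "bilinear_form_on s V B"
  shows "bilinear_form_on s V (\<lambda>v w. A v w + B v w)"
  using assms by (auto simp: bilinear_on_def linear_on_def algebra_simps)

lemma bilinear_form_on_scale:
  assumes "bilinear_form_on s V A"
  shows "bilinear_form_on s V (\<lambda>v w. c * A v w)"
  using assms by (auto simp: bilinear_on_def linear_on_def algebra_simps)

lemma bilinear_form_on_swap:
  "bilinear_form_on s V (\<lambda>v w. B w v) \<longleftrightarrow> bilinear_form_on s V B"
  by (auto simp: bilinear_on_def)

lemma tensor_square_add:
  assumes "T \<in> tensor_square s V" "bilinear_form_on s V A" "bilinear_form_on s V B"
  shows "T (\<lambda>v w. A v w + B v w) = T A + T B"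
  using assms(1) unfolding tensor_square_def
proof (induction rule: fs.span_induct_alt)
  case (step c x y)
  then show ?case using assms bilinear_form_on_add[OF assms(2,3)]
    by (auto simp: tens_def algebra_simps)
qed auto

lemma tensor_square_scale:
  assumes "T \<in> tensor_square s V" "bilinear_form_on s V A"
  shows "T (\<lambda>v w. c * A v w) = c * T A"
  using assms(1) unfolding tensor_square_def
proof (induction rule: fs.span_induct_alt)
  case (step d x y)
  then show ?case using assms bilinear_form_on_scale[OF assms(2)]
    by (auto simp: tens_def algebra_simps)
qed auto

lemma tensor_square_minus:
  assumes "T \<in> tensor_square s V" "bilinear_form_on s V A"
  shows "T (\<lambda>v w. - A v w) = - T A"
  using tensor_square_scale[OF assms, of "-1"] by simp

lemma tensor_square_cong:
  assumes "T \<in> tensor_square s V" "bilinear_form_on s V A" "bilinear_form_on s V B"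
    "\<And>v w. v \<in> V \<Longrightarrow> w \<in> V \<Longrightarrow> A v w = B v w"
  shows "T A = T B"
  using assms(1) unfolding tensor_square_def
proof (induction rule: fs.span_induct_alt)
  case (step c x y)
  then obtain v w where vw: "x = tens s V v w" and "v \<in> V" "w \<in> V" by auto
  then have "A v w = B v w" by (intro assms(4))
  then have "x A = x B" by (simp only: vw tens_def assms(2,3) if_True)
  then show ?case using step.IH by simp
qed simp

lemma tensor_square_swap:
  assumes "vector_space s" "module.subspace s V" "T \<in> tensor_square s V"
  shows "(\<lambda>B. T (\<lambda>v w. B w v)) \<in> tensor_square s V"
proof -
  obtain ps where ps: "set ps \<subseteq> V \<times> V" "T = tensor_of s V ps"
    using assms tensor_square_iff by blast
  have "(\<lambda>B. T (\<lambda>v w. B w v)) = tensor_of s V (map (\<lambda>(v, w). (w, v)) ps)"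
  proof
    fix B
    show "T (\<lambda>v w. B w v) = tensor_of s V (map (\<lambda>(v, w). (w, v)) ps) B"
      unfolding ps(2) tensor_of_def bilinear_form_on_swap[of s V B]
      by (simp add: o_def case_prod_unfold)
  qed
  moreover have "set (map (\<lambda>(v, w). (w, v)) ps) \<subseteq> V \<times> V" using ps(1) by auto
  ultimately show ?thesis
    unfolding tensor_square_iff[OF assms(1,2)] by blast
qed

lemma tensor_square_sum_list:
  assumes "T \<in> tensor_square s V" "\<And>x. x \<in> set xs \<Longrightarrow> bilinear_form_on s V (A x)"
  shows "T (\<lambda>v w. \<Sum>x\<leftarrow>xs. A x v w) = (\<Sum>x\<leftarrow>xs. T (A x)) \<and>
    bilinear_form_on s V (\<lambda>v w. \<Sum>x\<leftarrow>xs. A x v w)"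
  using assms(2)
proof (induction xs)
  case Nil
  have "bilinear_form_on s V (\<lambda>v w. 0)" by (auto simp: bilinear_on_def linear_on_def)
  moreover from this have "T (\<lambda>v w. 0) = 0" using tensor_square_scale[OF assms(1), of _ 0] by fastforce
  ultimately show ?case by simp
next
  case (Cons x xs)
  then show ?case
    using tensor_square_add[OF assms(1), of "A x"] bilinear_form_on_add[of s V "A x"] by simp
qed

section \<open>Brackets and cobrackets on tensors\<close>

lemma lie_algebra_onD:
  assumes "lie_algebra_on s V br"
  shows "vector_space s" "module.subspace s V" "x \<in> V \<Longrightarrow> y \<in> V \<Longrightarrow> br x y \<in> V"
    "x \<in> V \<Longrightarrow> linear_on s s V (br x)"
    "y \<in> V \<Longrightarrow> linear_on s s V (\<lambda>x. br x y)"
    "x \<in> V \<Longrightarrow> br x x = 0"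
    "x \<in> V \<Longrightarrow> y \<in> V \<Longrightarrow> z \<in> V \<Longrightarrow> br x (br y z) + br y (br z x) + br z (br x y) = 0"
  using assms unfolding lie_algebra_on_def bilinear_on_def by auto

lemma lie_algebra_skew:
  assumes "lie_algebra_on s V br" "x \<in> V" "y \<in> V"
  shows "br y x = - br x y"
proof -
  interpret vector_space s using lie_algebra_onD(1)[OF assms(1)] .
  have add: "\<And>a b c. a \<in> V \<Longrightarrow> b \<in> V \<Longrightarrow> c \<in> V \<Longrightarrow> br a (b + c) = br a b + br a c"
    "\<And>a b c. a \<in> V \<Longrightarrow> b \<in> V \<Longrightarrow> c \<in> V \<Longrightarrow> br (a + b) c = br a c + br b c"
    using lie_algebra_onD(4,5)[OF assms(1)] by (auto simp: linear_on_def)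
  have xy: "x + y \<in> V" using subspace_add[OF lie_algebra_onD(2)[OF assms(1)]] assms by blast
  have "br (x + y) (x + y) = br x x + br y x + (br x y + br y y)"
    using assms xy add by (simp add: algebra_simps)
  then show ?thesis using lie_algebra_onD(6)[OF assms(1)] assms xy
    by (simp add: eq_neg_iff_add_eq_0)
qed

lemma linear_on_neg:
  assumes "vector_space s" "module.subspace s V" "linear_on s t V F" "vector_space t" "x \<in> V"
  shows "F (- x) = - F x"
proof -
  interpret vs: vector_space s by fact
  interpret vt: vector_space t by fact
  have "F (s (- 1) x) = t (- 1) (F x)" using assms(3,5) unfolding linear_on_def by blast
  then show ?thesis by simp
qed

lemma lie_algebra_leibniz:
  assumes "lie_algebra_on s V br" "x \<in> V" "y \<in> V" "z \<in> V"
  shows "br (br x y) z = br x (br y z) - br y (br x z)"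
proof -
  note L = lie_algebra_onD[OF assms(1)]
  have 1: "br (br x y) z = - br z (br x y)"
    using lie_algebra_skew[OF assms(1) assms(4) L(3)[OF assms(2,3)]] .
  have 2: "br y (br z x) = - br y (br x z)"
    using lie_algebra_skew[OF assms(1) assms(2,4)]
      linear_on_neg[OF L(1,2) L(4)[OF assms(3)] L(1) L(3)[OF assms(2,4)]] by simp
  have 3: "br x (br y z) + br y (br z x) + br z (br x y) = 0"
    using L(7)[OF assms(2-4)] .
  have "br x (br y z) - br y (br x z) = - br z (br x y)"
    using 3 unfolding 2 by (simp add: eq_neg_iff_add_eq_0)
  then show ?thesis using 1 by simp
qed

lemma bilinear_form_on_act:
  assumes "lie_algebra_on s V br" "x \<in> V" "bilinear_form_on s V B"
  shows "bilinear_form_on s V (\<lambda>v w. B (br x v) w)"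
    "bilinear_form_on s V (\<lambda>v w. B v (br x w))"
    "bilinear_form_on s V (\<lambda>v w. B (br x v) w + B v (br x w))"
proof -
  note L = lie_algebra_onD[OF assms(1)]
  show "bilinear_form_on s V (\<lambda>v w. B (br x v) w)"
       "bilinear_form_on s V (\<lambda>v w. B v (br x w))"
    using assms(3) L(3,4)[OF assms(2)] unfolding bilinear_on_def linear_on_def by auto
  then show "bilinear_form_on s V (\<lambda>v w. B (br x v) w + B v (br x w))"
    by (rule bilinear_form_on_add)
qed

lemma act_in_tensor_square:
  assumes "lie_algebra_on s V br" "x \<in> V" "T \<in> tensor_square s V"
  shows "act s V br x T \<in> tensor_square s V"
proof -
  note L = lie_algebra_onD[OF assms(1)]
  show ?thesis using assms(3) unfolding tensor_square_def
  proof (induction rule: fs.span_induct_alt)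
    case base
    have "act s V br x 0 = 0" by (auto simp: act_def fun_eq_iff)
    then show ?case by (simp only: fs.span_zero)
  next
    case (step c T T')
    then obtain v w where vw: "T = tens s V v w" "v \<in> V" "w \<in> V" by blast
    have "act s V br x (fun_scale c T + T') = fun_scale c (act s V br x T) + act s V br x T'"
      by (auto simp: act_def fun_eq_iff)
    also have "act s V br x T = tens s V (br x v) w + tens s V v (br x w)"
      using act_tens[OF assms(1,2)] vw by simp
    finally have eq: "act s V br x (fun_scale c T + T') =
      fun_scale c (tens s V (br x v) w + tens s V v (br x w)) + act s V br x T'" .
    have "tens s V (br x v) w \<in> {tens s V v w | v w. v \<in> V \<and> w \<in> V}"
         "tens s V v (br x w) \<in> {tens s V v w | v w. v \<in> V \<and> w \<in> V}"
      using vw assms(2) L(3) by blast+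
    then show ?case unfolding eq
      by (intro fs.span_add fs.span_scale fs.span_base step.IH)
  qed
qed

lemma trilinear_form_rotate:
  "trilinear_form_on s V T \<Longrightarrow> trilinear_form_on s V (\<lambda>u a b. T a b u)"
  by (simp add: trilinear_on_def bilinear_on_def)

text \<open>This makes \<open>(id \<otimes> \<delta>) (\<delta> x)\<close>, tested against a trilinear form, accessible to the
  evaluation rules for tensors.\<close>

lemma bilinear_form_on_cobracket:
  assumes "vector_space s" "module.subspace s V"
    "\<And>x. x \<in> V \<Longrightarrow> \<delta> x \<in> tensor_square s V" "linear_on s fun_scale V \<delta>"
    "trilinear_form_on s V T"
  shows "bilinear_form_on s V (\<lambda>u v. \<delta> v (T u))"
proof -
  interpret vs: vector_space s by fact
  have B: "bilinear_form_on s V (T u)" if "u \<in> V" for u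
    using assms(5) that by (simp add: trilinear_on_def)
  have "linear_on s (*) V (\<lambda>u. \<delta> v (T u))" if v: "v \<in> V" for v
    unfolding linear_on_def
  proof (intro conjI ballI allI)
    fix u u' assume u: "u \<in> V" "u' \<in> V"
    have "\<delta> v (T (u + u')) = \<delta> v (\<lambda>a b. T u a b + T u' a b)"
      using assms(5) u vs.subspace_add[OF assms(2) u]
      by (intro tensor_square_cong[OF assms(3)[OF v]] bilinear_form_on_add B)
         (auto simp: trilinear_on_def linear_on_def)
    then show "\<delta> v (T (u + u')) = \<delta> v (T u) + \<delta> v (T u')"
      using tensor_square_add[OF assms(3)[OF v] B B] u by simp
  next
    fix c u assume u: "u \<in> V"
    have "\<delta> v (T (s c u)) = \<delta> v (\<lambda>a b. c * T u a b)"
      using assms(5) u vs.subspace_scale[OF assms(2) u]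
      by (intro tensor_square_cong[OF assms(3)[OF v]] bilinear_form_on_scale B)
         (auto simp: trilinear_on_def linear_on_def)
    then show "\<delta> v (T (s c u)) = c * \<delta> v (T u)"
      using tensor_square_scale[OF assms(3)[OF v] B] u by simp
  qed
  moreover have "linear_on s (*) V (\<lambda>v. \<delta> v (T u))" for u
    using assms(4) by (auto simp: linear_on_def fun_scale_def)
  ultimately show ?thesis by (simp add: bilinear_on_def)
qed

section \<open>Interpolation in spaces of functions\<close>

text \<open>The functions \<open>e p\<close> are dual to evaluation at the points \<open>p\<close>, and they span the same space
  as \<open>S\<close>. In the induction step, the difference \<open>t\<close> of the new function and its interpolant vanishes at
  the old points. Unless \<open>t\<close> is zero, a point where it does not vanish is added, and multiples of \<open>t\<close>
  are subtracted from the old functions to make them vanish there.\<close>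

lemma interpolation_points:
  fixes S :: "('x \<Rightarrow> 'k::field) set"
  assumes "finite S"
  obtains P e where "finite P" "\<And>p. p \<in> P \<Longrightarrow> e p \<in> fs.span S"
    "\<And>p q. p \<in> P \<Longrightarrow> q \<in> P \<Longrightarrow> e p q = (if p = q then 1 else 0)"
    "\<And>w x. w \<in> fs.span S \<Longrightarrow> w x = (\<Sum>p\<in>P. w p * e p x)"
  using assms
proof (induction S arbitrary: thesis rule: finite_induct)
  case empty
  have 0: "w = 0" if "w \<in> fs.span {}" for w :: "'x \<Rightarrow> 'k"
    using that fs.span_empty by blast
  show ?case
    by (rule empty[of "{}" "\<lambda>_. 0"]) (auto simp del: fun_scale_apply dest: 0)
next
  case (insert s S)
  obtain P e where P: "finite P" and e: "\<And>p. p \<in> P \<Longrightarrow> e p \<in> fs.span S"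
    and \<delta>: "\<And>p q. p \<in> P \<Longrightarrow> q \<in> P \<Longrightarrow> e p q = (if p = q then 1 else 0)"
    and rep: "\<And>w x. w \<in> fs.span S \<Longrightarrow> w x = (\<Sum>p\<in>P. w p * e p x)"
    by (fact insert.IH)
  define s' where "s' = (\<Sum>p\<in>P. fun_scale (s p) (e p))"
  define t where "t = s - s'"
  have s': "s' \<in> fs.span S"
    unfolding s'_def by (intro fs.span_sum fs.span_scale e)
  have s'_apply: "s' x = (\<Sum>p\<in>P. s p * e p x)" for x
    unfolding s'_def using P by (induction P rule: finite_induct) auto
  have tP: "t p = 0" if "p \<in> P" for p
    using that P by (simp add: t_def s'_apply \<delta> if_distrib cong: if_cong)
  show ?case
  proof (cases "t = 0")
    case True
    then have "s \<in> fs.span S" using s' by (simp add: t_def)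
    then have "fs.span (insert s S) = fs.span S" by (rule fs.span_redundant)
    then show ?thesis using P e \<delta> rep by (intro insert.prems[of P e]) (simp_all only:)
  next
    case False
    then obtain y where y: "t y \<noteq> 0" by (auto simp: fun_eq_iff)
    then have yP: "y \<notin> P" using tP by auto
    define f where "f = fun_scale (1 / t y) t"
    define e' where "e' = (\<lambda>p. if p = y then f else e p - fun_scale (e p y) f)"
    have mono: "v \<in> fs.span (insert s S)" if "v \<in> fs.span S" for v
      using that fs.span_mono[of S "insert s S"] by blast
    have f: "f \<in> fs.span (insert s S)"
      unfolding f_def t_def by (intro fs.span_scale fs.span_diff mono s' fs.span_base) simp
    have fP: "f p = 0" if "p \<in> P" for p using tP[OF that] by (simp add: f_def)
    have fy: "f y = 1" using y by (simp add: f_def)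
    have e'P: "e' p = e p - fun_scale (e p y) f" if "p \<in> P" for p
      using that yP by (auto simp: e'_def)
    have e'y: "e' y = f" by (simp add: e'_def)
    have "e' p \<in> fs.span (insert s S)" if "p \<in> insert y P" for p
    proof (cases "p = y")
      case True
      then show ?thesis using f e'y by simp
    next
      case False
      then have "p \<in> P" using that by simp
      then show ?thesis unfolding e'P[OF \<open>p \<in> P\<close>]
        by (intro fs.span_diff fs.span_scale f mono e)
    qed
    moreover have "e' p q = (if p = q then 1 else 0)" if "p \<in> insert y P" "q \<in> insert y P" for p q
      using that yP \<delta> by (auto simp: e'P e'y fP fy)
    moreover have "w x = (\<Sum>p\<in>insert y P. w p * e' p x)" if w_span: "w \<in> fs.span (insert s S)" for w x
    proof -
      obtain k where k: "w - fun_scale k s \<in> fs.span S"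
        using w_span unfolding fs.span_breakdown_eq by blast
      define v where "v = (w - fun_scale k s) + fun_scale k s'"
      have v: "v \<in> fs.span S" unfolding v_def by (intro fs.span_add fs.span_scale k s')
      have w: "w z = v z + k * t z" for z by (simp add: v_def t_def algebra_simps)
      have wP: "w p = v p" if "p \<in> P" for p using tP[OF that] w by simp
      have "(\<Sum>p\<in>P. w p * e' p x) = (\<Sum>p\<in>P. v p * e p x - (v p * e p y) * f x)"
        by (rule sum.cong) (auto simp: wP e'P algebra_simps)
      also have "\<dots> = v x - v y * f x"
        using rep[OF v, of x] rep[OF v, of y] by (simp add: sum_subtractf sum_distrib_right)
      finally have "(\<Sum>p\<in>insert y P. w p * e' p x) = w y * f x + (v x - v y * f x)"
        using P yP by (simp add: e'y)
      also have "\<dots> = v x + k * t x" using y by (simp add: w f_def field_simps)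
      finally show ?thesis by (simp add: w)
    qed
    ultimately show ?thesis using P by (intro insert.prems[of "insert y P" e'])
        (simp_all del: fun_scale_apply)
  qed
qed

text \<open>On a finite-dimensional space of functions every linear form is a combination of
  evaluations.\<close>

lemma linear_form_interpolation:
  fixes S :: "('x \<Rightarrow> 'k::field) set"
  assumes "finite S" "S \<subseteq> V" "fs.subspace V"
  obtains P e where "finite P" "\<And>p. p \<in> P \<Longrightarrow> e p \<in> V"
    "\<And>w F. w \<in> S \<Longrightarrow> linear_on fun_scale (*) V F \<Longrightarrow> F w = (\<Sum>p\<in>P. w p * F (e p))"
proof -
  obtain P e where P: "finite P" and e: "\<And>p. p \<in> P \<Longrightarrow> e p \<in> fs.span S"
    and "\<And>p q. p \<in> P \<Longrightarrow> q \<in> P \<Longrightarrow> e p q = (if p = q then 1 else 0)"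
    and rep: "\<And>w x. w \<in> fs.span S \<Longrightarrow> w x = (\<Sum>p\<in>P. w p * e p x)"
    by (fact interpolation_points[OF assms(1)])
  have "fs.span S \<subseteq> V" using assms by (simp add: fs.span_minimal)
  then have eV: "e p \<in> V" if "p \<in> P" for p using e that by blast
  show ?thesis
  proof (rule that[OF P eV])
    fix w F assume w: "w \<in> S" and F: "linear_on fun_scale (*) V F"
    have "(\<Sum>p\<in>P. fun_scale (w p) (e p)) x = (\<Sum>p\<in>P. w p * e p x)" for x
      using P by (induction P rule: finite_induct) auto
    then have "w = (\<Sum>p\<in>P. fun_scale (w p) (e p))"
      by (intro ext) (simp only: rep[OF fs.span_base[OF w], symmetric])
    then have "F w = F (\<Sum>p\<in>P. fun_scale (w p) (e p))" by simp
    also have "\<dots> = (\<Sum>p\<in>P. F (fun_scale (w p) (e p)))"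
      using eV assms(3)
      by (intro linear_on_sum[OF vector_space_fun_scale assms(3) F vector_space_mult P] fs.subspace_scale)
    also have "\<dots> = (\<Sum>p\<in>P. w p * F (e p))"
      using F eV by (intro sum.cong) (auto simp: linear_on_def)
    finally show "F w = (\<Sum>p\<in>P. w p * F (e p))" .
  qed
qed

text \<open>A sum of pure tensors of three functions that vanishes as a function of three arguments
  vanishes in \<open>V \<otimes> V \<otimes> V\<close>.\<close>

lemma trilinear_sum_eq_0:
  fixes ts :: "(('x \<Rightarrow> 'k::field) \<times> ('x \<Rightarrow> 'k) \<times> ('x \<Rightarrow> 'k)) list"
  assumes V: "fs.subspace V" and ts: "set ts \<subseteq> V \<times> V \<times> V" and T: "trilinear_form_on fun_scale V T"
    and eq0: "\<And>x y z. (\<Sum>(f, g, h)\<leftarrow>ts. f x * g y * h z) = 0"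
  shows "(\<Sum>(f, g, h)\<leftarrow>ts. T f g h) = 0"
proof -
  define S where "S = (\<Union>(f, g, h)\<in>set ts. {f, g, h})"
  have fin_S: "finite S" and S_V: "S \<subseteq> V" using ts by (auto simp: S_def)
  obtain P e where P: "finite P" "\<And>p. p \<in> P \<Longrightarrow> e p \<in> V"
    and rep: "\<And>w F. w \<in> S \<Longrightarrow> linear_on fun_scale (*) V F \<Longrightarrow> F w = (\<Sum>p\<in>P. w p * F (e p))"
    by (fact linear_form_interpolation[OF fin_S S_V V])
  have "T f g h = (\<Sum>p\<in>P. \<Sum>q\<in>P. \<Sum>r\<in>P. (f p * g q * h r) * T (e p) (e q) (e r))"
    if "(f, g, h) \<in> set ts" for f g h
  proof -
    have in_S: "f \<in> S" "g \<in> S" "h \<in> S" and in_V: "g \<in> V" "h \<in> V"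
      using that ts by (auto simp: S_def)
    have "T f g h = (\<Sum>p\<in>P. f p * T (e p) g h)"
      using T in_V by (intro rep[OF in_S(1), of "\<lambda>f. T f g h"]) (auto simp: trilinear_on_def)
    also have "\<dots> = (\<Sum>p\<in>P. f p * (\<Sum>q\<in>P. g q * T (e p) (e q) h))"
      using T in_V P(2)
      by (intro sum.cong arg_cong2[of _ _ _ _ "(*)"] rep[OF in_S(2), of "\<lambda>g. T _ g h"])
         (auto simp: trilinear_on_def bilinear_on_def)
    also have "\<dots> = (\<Sum>p\<in>P. f p * (\<Sum>q\<in>P. g q * (\<Sum>r\<in>P. h r * T (e p) (e q) (e r))))"
      using T in_V P(2)
      by (intro sum.cong arg_cong2[of _ _ _ _ "(*)"] rep[OF in_S(3), of "\<lambda>h. T _ _ h"])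
         (auto simp: trilinear_on_def bilinear_on_def)
    finally show ?thesis by (simp add: sum_distrib_left mult.assoc)
  qed
  then have "(\<Sum>(f, g, h)\<leftarrow>ts. T f g h) =
      (\<Sum>(f, g, h)\<leftarrow>ts. \<Sum>p\<in>P. \<Sum>q\<in>P. \<Sum>r\<in>P. (f p * g q * h r) * T (e p) (e q) (e r))"
    by (intro arg_cong[of _ _ sum_list] map_cong) auto
  also have "\<dots> = (\<Sum>p\<in>P. \<Sum>q\<in>P. \<Sum>r\<in>P. (\<Sum>(f, g, h)\<leftarrow>ts. f p * g q * h r) * T (e p) (e q) (e r))"
    by (simp add: case_prod_unfold sum_list_sum_swap sum_list_mult_const)
  finally show ?thesis by (simp add: eq0)
qed

lemma bilinear_form_on_eval: "bilinear_form_on fun_scale V (\<lambda>f h. f x * h y)"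
  by (auto simp: bilinear_on_def linear_on_def algebra_simps)

text \<open>A tensor of functions is determined by its values as a function of two arguments.\<close>

lemma tensor_eqI:
  fixes T :: "('k::field, 'x \<Rightarrow> 'k) tensor"
  assumes V: "fs.subspace V"
    and T: "T \<in> tensor_square fun_scale V" "T' \<in> tensor_square fun_scale V"
    and eq: "\<And>x y. form_of_tensor T x y = form_of_tensor T' x y"
  shows "T = T'"
proof -
  have "T - T' \<in> tensor_square fun_scale V"
    using T unfolding tensor_square_def by (rule fs.span_diff)
  then obtain ps where ps: "set ps \<subseteq> V \<times> V" "T - T' = tensor_of fun_scale V ps"
    using tensor_square_iff[OF vector_space_fun_scale V] by blast
  have ev: "(\<Sum>(f, h)\<leftarrow>ps. f x * h y) = 0" for x y
  proof -
    have "(\<Sum>(f, h)\<leftarrow>ps. f x * h y) = (T - T') (\<lambda>f h. f x * h y)"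
      unfolding ps(2) by (simp only: tensor_of_apply[OF bilinear_form_on_eval])
    then show ?thesis using eq[of x y] by (simp add: form_of_tensor_def)
  qed
  define S where "S = (\<Union>(f, h)\<in>set ps. {f, h})"
  have fin_S: "finite S" and S_V: "S \<subseteq> V" using ps(1) by (auto simp: S_def)
  obtain P e where P: "finite P" "\<And>p. p \<in> P \<Longrightarrow> e p \<in> V"
    and rep: "\<And>w F. w \<in> S \<Longrightarrow> linear_on fun_scale (*) V F \<Longrightarrow> F w = (\<Sum>p\<in>P. w p * F (e p))"
    by (fact linear_form_interpolation[OF fin_S S_V V])
  have "(\<Sum>(f, h)\<leftarrow>ps. B f h) = 0" if B: "bilinear_form_on fun_scale V B" for B
  proof -
    have "B f h = (\<Sum>p\<in>P. \<Sum>q\<in>P. (f p * h q) * B (e p) (e q))" if "(f, h) \<in> set ps" for f h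
    proof -
      have in_S: "f \<in> S" "h \<in> S" and "h \<in> V" using that ps by (auto simp: S_def)
      then have "B f h = (\<Sum>p\<in>P. f p * B (e p) h)"
        using B by (intro rep[OF in_S(1), of "\<lambda>f. B f h"]) (auto simp: bilinear_on_def)
      also have "\<dots> = (\<Sum>p\<in>P. f p * (\<Sum>q\<in>P. h q * B (e p) (e q)))"
        using B P(2)
        by (intro sum.cong arg_cong2[of _ _ _ _ "(*)"] rep[OF in_S(2), of "\<lambda>h. B _ h"])
           (auto simp: bilinear_on_def)
      finally show ?thesis by (simp add: sum_distrib_left mult.assoc)
    qed
    then have "(\<Sum>(f, h)\<leftarrow>ps. B f h) =
        (\<Sum>(f, h)\<leftarrow>ps. \<Sum>p\<in>P. \<Sum>q\<in>P. (f p * h q) * B (e p) (e q))"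
      by (intro arg_cong[of _ _ sum_list] map_cong) auto
    also have "\<dots> = (\<Sum>p\<in>P. \<Sum>q\<in>P. (\<Sum>(f, h)\<leftarrow>ps. f p * h q) * B (e p) (e q))"
      by (simp add: case_prod_unfold sum_list_sum_swap sum_list_mult_const)
    finally show ?thesis by (simp add: ev)
  qed
  then have "(T - T') B = 0" for B unfolding ps(2) tensor_of_def by auto
  then show ?thesis by (auto simp: fun_eq_iff)
qed

section \<open>Linear forms and forms of finite rank\<close>

lemma form_of_tensor_add: "form_of_tensor (T + T') \<xi> \<eta> = form_of_tensor T \<xi> \<eta> + form_of_tensor T' \<xi> \<eta>"
  by (simp add: form_of_tensor_def)

lemma form_of_tensor_diff: "form_of_tensor (T - T') \<xi> \<eta> = form_of_tensor T \<xi> \<eta> - form_of_tensor T' \<xi> \<eta>"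
  by (simp add: form_of_tensor_def)

lemma form_of_tensor_scale: "form_of_tensor (fun_scale c T) \<xi> \<eta> = c * form_of_tensor T \<xi> \<eta>"
  by (simp add: form_of_tensor_def)

lemma form_of_tensor_of:
  "form_of_tensor (tensor_of fun_scale V ps) \<xi> \<eta> = (\<Sum>(f, h)\<leftarrow>ps. f \<xi> * h \<eta>)"
  unfolding form_of_tensor_def by (rule tensor_of_apply[OF bilinear_form_on_eval])

lemma dual_spaceD:
  assumes "f \<in> dual_space s"
  shows "f (x + y) = f x + f y" "f (s c x) = c * f x" "f (- x) = - f x" "f (x - y) = f x - f y" "f 0 = 0"
proof -
  interpret Vector_Spaces.linear s "(*)" f using assms by (simp add: dual_space_def)
  show "f (x + y) = f x + f y" "f (s c x) = c * f x" "f (- x) = - f x" "f (x - y) = f x - f y" "f 0 = 0"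
    by (rule add scale neg diff zero)+
qed

lemma dual_spaceI:
  assumes "vector_space s" "\<And>x y. f (x + y) = f x + f y" "\<And>c x. f (s c x) = c * f x"
  shows "f \<in> dual_space s"
  using assms vector_space_mult
  by (simp add: dual_space_def Vector_Spaces.linear_iff)

lemma bilinear_form_tens:
  assumes "f \<in> dual_space s" "h \<in> dual_space s"
  shows "bilinear_form_on s UNIV (form_tens f h)"
  unfolding bilinear_on_def linear_on_def form_tens_def
  by (simp add: dual_spaceD[OF assms(1)] dual_spaceD[OF assms(2)] algebra_simps)

text \<open>A form in the span of the products of two elements of \<open>U\<close> is given by a finite list of pairs.\<close>

lemma form_tens_span:
  assumes "F \<in> fs2.span {form_tens f h | f h. f \<in> U \<and> h \<in> U}" "fs.subspace U"
  shows "\<exists>ps. set ps \<subseteq> U \<times> U \<and> (\<forall>\<xi> \<eta>. F \<xi> \<eta> = (\<Sum>(f, h)\<leftarrow>ps. f \<xi> * h \<eta>))"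
  using assms(1)
proof (induction rule: fs2.span_induct_alt)
  case base
  show ?case by (rule exI[of _ "[]"]) simp
next
  case (step c F G)
  then obtain f h ps where "F = form_tens f h" "f \<in> U" "h \<in> U" "set ps \<subseteq> U \<times> U"
    "\<forall>\<xi> \<eta>. G \<xi> \<eta> = (\<Sum>(f, h)\<leftarrow>ps. f \<xi> * h \<eta>)" by blast
  then show ?case using fs.subspace_scale[OF assms(2)]
    by (intro exI[of _ "(fun_scale c f, h) # ps"]) (auto simp: form_tens_def mult.assoc simp del: fun_scale_apply; simp add: fun_scale_def mult.assoc)
qed

section \<open>Duals of Lie bialgebras\<close>

text \<open>A Lie bialgebra, and a good subspace \<open>V\<close> of its dual that is stable under the dual bracket.\<close>

context
  fixes s :: "'k::field_char_0 \<Rightarrow> 'v::ab_group_add \<Rightarrow> 'v"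
    and br :: "'v \<Rightarrow> 'v \<Rightarrow> 'v" and \<delta> :: "'v \<Rightarrow> ('k, 'v) tensor" and V :: "('v \<Rightarrow> 'k) set"
  assumes bialg: "lie_bialgebra_on s UNIV br \<delta>"
    and good: "good_subspace s br V"
    and closed: "\<And>f h. f \<in> V \<Longrightarrow> h \<in> V \<Longrightarrow> dual_bracket \<delta> f h \<in> V"
begin

private lemma lie: "lie_algebra_on s UNIV br"
  using bialg by (simp add: lie_bialgebra_on_def)

private lemma vs: "vector_space s" using lie_algebra_onD(1)[OF lie] .

private lemma V_sub: "fs.subspace V" and V_dual: "f \<in> V \<Longrightarrow> f \<in> dual_space s"
  using good by (auto simp: good_subspace_def)

private lemma \<delta>_tens: "\<delta> x \<in> tensor_square s UNIV"
  and \<delta>_lin: "linear_on s fun_scale UNIV \<delta>"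
  and \<delta>_skew: "bilinear_form_on s UNIV B \<Longrightarrow> \<delta> x (\<lambda>v w. B w v) = - \<delta> x B"
  and \<delta>_jacobi: "trilinear_form_on s UNIV T \<Longrightarrow> \<delta> x (\<lambda>u v. \<delta> v (\<lambda>a b. T u a b))
      + \<delta> x (\<lambda>u v. \<delta> v (\<lambda>a b. T a b u)) + \<delta> x (\<lambda>u v. \<delta> v (\<lambda>a b. T b u a)) = 0"
  using bialg by (simp_all add: lie_bialgebra_on_def lie_cobracket_on_def)

private lemma \<delta>_cocycle: "\<delta> (br x y) = act s UNIV br x (\<delta> y) - act s UNIV br y (\<delta> x)"
  using bialg by (simp add: lie_bialgebra_on_def)

private lemma br_add: "br x (y + z) = br x y + br x z" "br (x + y) z = br x z + br y z"
  and br_scale: "br x (s c y) = s c (br x y)" "br (s c x) y = s c (br x y)"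
  using lie by (simp_all add: lie_algebra_on_def bilinear_on_def linear_on_def)

private lemma br_skew: "br y x = - br x y"
  using lie_algebra_skew[OF lie] by blast

private lemma dual_ad:
  assumes "f \<in> dual_space s"
  shows "(\<lambda>v. f (br x v)) \<in> dual_space s" "(\<lambda>v. f (br v x)) \<in> dual_space s"
  using assms by (auto intro!: dual_spaceI vs simp: br_add br_scale dual_spaceD)

private lemma lie_algebra_dual: "lie_algebra_on fun_scale V (dual_bracket \<delta>)"
  unfolding lie_algebra_on_def
proof (intro conjI ballI vector_space_fun_scale V_sub closed)
  note [intro] = bilinear_form_tens V_dual \<delta>_tens
  show "bilinear_on fun_scale fun_scale V (dual_bracket \<delta>)"
    unfolding bilinear_on_def linear_on_def
  proof (intro conjI ballI allI ext)
    fix f g h :: "'v \<Rightarrow> 'k" and c :: 'k and \<xi>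
    assume fgh: "f \<in> V" "g \<in> V" "h \<in> V"
    have "form_tens f (g + h) = (\<lambda>v w. form_tens f g v w + form_tens f h v w)"
         "form_tens (g + h) f = (\<lambda>v w. form_tens g f v w + form_tens h f v w)"
         "form_tens f (fun_scale c g) = (\<lambda>v w. c * form_tens f g v w)"
         "form_tens (fun_scale c g) f = (\<lambda>v w. c * form_tens g f v w)"
      by (auto simp: form_tens_def fun_eq_iff algebra_simps)
    then show "dual_bracket \<delta> f (g + h) \<xi> = (dual_bracket \<delta> f g + dual_bracket \<delta> f h) \<xi>"
         "dual_bracket \<delta> (g + h) f \<xi> = (dual_bracket \<delta> g f + dual_bracket \<delta> h f) \<xi>"
         "dual_bracket \<delta> f (fun_scale c g) \<xi> = fun_scale c (dual_bracket \<delta> f g) \<xi>"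
         "dual_bracket \<delta> (fun_scale c g) f \<xi> = fun_scale c (dual_bracket \<delta> g f) \<xi>"
      using fgh by (simp_all add: dual_bracket_def tensor_square_add[OF \<delta>_tens bilinear_form_tens bilinear_form_tens]
          tensor_square_scale[OF \<delta>_tens bilinear_form_tens] V_dual)
  qed
  show "dual_bracket \<delta> f f = 0" if "f \<in> V" for f
  proof
    fix \<xi>
    have "form_tens f f = (\<lambda>v w. form_tens f f w v)" by (auto simp: form_tens_def fun_eq_iff)
    then have "\<delta> \<xi> (form_tens f f) = - \<delta> \<xi> (form_tens f f)"
      using \<delta>_skew[OF bilinear_form_tens, of f f] V_dual[OF that] by metis
    then show "dual_bracket \<delta> f f \<xi> = 0 \<xi>" by (simp add: dual_bracket_def)
  qed
  fix f g h assume fgh: "f \<in> V" "g \<in> V" "h \<in> V"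
  have nested: "dual_bracket \<delta> f (dual_bracket \<delta> g h) \<xi> = \<delta> \<xi> (\<lambda>u v. \<delta> v (\<lambda>a b. f u * (g a * h b)))"
    if "f \<in> V" "g \<in> V" "h \<in> V" for f g h \<xi>
    using tensor_square_scale[OF \<delta>_tens bilinear_form_tens, of g h] that V_dual
    by (simp add: dual_bracket_def form_tens_def)
  have T: "trilinear_form_on s UNIV (\<lambda>u a b. f u * (g a * h b))"
    unfolding trilinear_on_def bilinear_on_def linear_on_def
    by (simp add: fgh[THEN V_dual, THEN dual_spaceD(1)] fgh[THEN V_dual, THEN dual_spaceD(2)] algebra_simps)
  show "dual_bracket \<delta> f (dual_bracket \<delta> g h) + dual_bracket \<delta> g (dual_bracket \<delta> h f)
      + dual_bracket \<delta> h (dual_bracket \<delta> f g) = 0"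
  proof
    fix \<xi>
    show "(dual_bracket \<delta> f (dual_bracket \<delta> g h) + dual_bracket \<delta> g (dual_bracket \<delta> h f)
      + dual_bracket \<delta> h (dual_bracket \<delta> f g)) \<xi> = 0 \<xi>"
      using \<delta>_jacobi[OF T, of \<xi>] fgh by (simp add: nested ac_simps)
  qed
qed

text \<open>The dual cobracket, taking \<open>f\<close> to \<open>(\<xi>, \<eta>) \<mapsto> f [\<xi>, \<eta>]\<close>, has values in \<open>V \<otimes> V\<close> because \<open>V\<close> is good; all
  identities between such tensors can be checked on arguments of the functions, where they
  are identities in the given Lie bialgebra.\<close>

lemma dual_lie_bialgebra_exists:
  "\<exists>D. lie_bialgebra_on fun_scale V (dual_bracket \<delta>) D \<and>
    (\<forall>f\<in>V. form_of_tensor (D f) = dual_cobracket br f)"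
proof -
  let ?b = "dual_bracket \<delta>"
  have "\<exists>ps. set ps \<subseteq> V \<times> V \<and> (\<forall>\<xi> \<eta>. f (br \<xi> \<eta>) = (\<Sum>(g, h)\<leftarrow>ps. g \<xi> * h \<eta>))" if "f \<in> V" for f
    using form_tens_span[OF _ V_sub, of "dual_cobracket br f"] good that
    unfolding good_subspace_def dual_cobracket_def by blast
  then obtain R where R: "\<And>f. f \<in> V \<Longrightarrow> set (R f) \<subseteq> V \<times> V"
    and R_br: "\<And>f \<xi> \<eta>. f \<in> V \<Longrightarrow> f (br \<xi> \<eta>) = (\<Sum>(g, h)\<leftarrow>R f. g \<xi> * h \<eta>)" by metis
  define D where "D = (\<lambda>f. tensor_of fun_scale V (R f))"
  have form_D: "form_of_tensor (D f) \<xi> \<eta> = f (br \<xi> \<eta>)" if "f \<in> V" for f \<xi> \<eta>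
    using R_br[OF that] by (simp add: D_def form_of_tensor_of)
  have D_tens: "D f \<in> tensor_square fun_scale V" if "f \<in> V" for f
    using R[OF that] unfolding D_def tensor_square_iff[OF vector_space_fun_scale V_sub] by blast
  have D_apply: "D f B = (\<Sum>(g, h)\<leftarrow>R f. B g h)" if "bilinear_form_on fun_scale V B" for f B
    unfolding D_def by (rule tensor_of_apply[OF that])
  note eqI = tensor_eqI[OF V_sub]
  have tens_sub: "fs.subspace (tensor_square fun_scale V)"
    unfolding tensor_square_def by (rule fs.subspace_span)

  have D_lin: "linear_on fun_scale fun_scale V D"
    unfolding linear_on_def
  proof (intro conjI ballI allI)
    fix f g assume fg: "f \<in> V" "g \<in> V"
    then have "f + g \<in> V" using fs.subspace_add[OF V_sub] by blast
    then show "D (f + g) = D f + D g" using fg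
      by (intro eqI fs.subspace_add[OF tens_sub] D_tens) (simp_all add: form_of_tensor_add form_D)
  next
    fix f c assume f: "f \<in> V"
    then have "fun_scale c f \<in> V" using fs.subspace_scale[OF V_sub] by blast
    then show "D (fun_scale c f) = fun_scale c (D f)" using f
      by (intro eqI fs.subspace_scale[OF tens_sub] D_tens)
         (simp_all only: form_of_tensor_scale form_D fun_scale_apply)
  qed

  have D_skew: "D f (\<lambda>g h. B h g) = - D f B" if f: "f \<in> V" for f B
  proof -
    have "(\<lambda>B. D f (\<lambda>g h. B h g)) = - D f"
    proof (rule eqI)
      show "(\<lambda>B. D f (\<lambda>g h. B h g)) \<in> tensor_square fun_scale V"
        by (rule tensor_square_swap[OF vector_space_fun_scale V_sub D_tens[OF f]])
      show "- D f \<in> tensor_square fun_scale V"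
        by (intro fs.subspace_neg[OF tens_sub] D_tens f)
      fix \<xi> \<eta>
      have "form_of_tensor (\<lambda>B. D f (\<lambda>g h. B h g)) \<xi> \<eta> = form_of_tensor (D f) \<eta> \<xi>"
        by (simp add: form_of_tensor_def mult.commute)
      also have "\<dots> = - f (br \<xi> \<eta>)"
        using br_skew[of \<eta> \<xi>] by (simp add: form_D f dual_spaceD(3)[OF V_dual])
      also have "\<dots> = - form_of_tensor (D f) \<xi> \<eta>" by (simp add: form_D f)
      finally show "form_of_tensor (\<lambda>B. D f (\<lambda>g h. B h g)) \<xi> \<eta> = form_of_tensor (- D f) \<xi> \<eta>"
        by (simp add: form_of_tensor_def)
    qed
    from fun_cong[OF this, of B] show ?thesis by simp
  qed

  have D_jacobi: "D f (\<lambda>u v. D v (\<lambda>a b. T u a b)) + D f (\<lambda>u v. D v (\<lambda>a b. T a b u))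
      + D f (\<lambda>u v. D v (\<lambda>a b. T b u a)) = 0"
    if f: "f \<in> V" and T: "trilinear_form_on fun_scale V T" for f T
  proof -
    define ts where "ts = concat (map (\<lambda>(g, h). map (\<lambda>(k, l). (g, k, l)) (R h)) (R f))"
    have sum_ts: "(\<Sum>(g, k, l)\<leftarrow>ts. S g k l) = (\<Sum>(g, h)\<leftarrow>R f. \<Sum>(k, l)\<leftarrow>R h. S g k l)"
      for S :: "('v \<Rightarrow> 'k) \<Rightarrow> ('v \<Rightarrow> 'k) \<Rightarrow> ('v \<Rightarrow> 'k) \<Rightarrow> 'k"
    proof -
      have "(\<Sum>(g, k, l)\<leftarrow>concat (map (\<lambda>(g, h). map (\<lambda>(k, l). (g, k, l)) (R h)) ps). S g k l)
          = (\<Sum>(g, h)\<leftarrow>ps. \<Sum>(k, l)\<leftarrow>R h. S g k l)" for ps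
        by (induction ps) (auto simp: o_def case_prod_unfold)
      then show ?thesis unfolding ts_def .
    qed
    have ts_V: "set ts \<subseteq> V \<times> V \<times> V" using R[OF f] R unfolding ts_def by fastforce
    have double: "D f (\<lambda>u v. D v (S u)) = (\<Sum>(g, k, l)\<leftarrow>ts. S g k l)"
      if S: "trilinear_form_on fun_scale V S" for S
    proof -
      have "D f (\<lambda>u v. D v (S u)) = (\<Sum>(g, h)\<leftarrow>R f. D h (S g))"
        by (rule D_apply[OF bilinear_form_on_cobracket[OF vector_space_fun_scale V_sub D_tens D_lin S]])
      also have "\<dots> = (\<Sum>(g, h)\<leftarrow>R f. \<Sum>(k, l)\<leftarrow>R h. S g k l)"
        using R[OF f] S
        by (intro arg_cong[of _ _ sum_list] map_cong) (auto simp: trilinear_on_def intro!: D_apply)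
      finally show ?thesis by (simp add: sum_ts)
    qed
    \<comment> \<open>\<open>ts\<close> represents \<open>(id \<otimes> D) (D f)\<close>, and \<open>ts'\<close> the sum of its cyclic permutations.\<close>
    define ts' where "ts' = ts @ map (\<lambda>(g, k, l). (k, l, g)) ts @ map (\<lambda>(g, k, l). (l, g, k)) ts"
    have sum_ts': "(\<Sum>(g, k, l)\<leftarrow>ts'. S g k l) = (\<Sum>(g, k, l)\<leftarrow>ts. S g k l)
        + (\<Sum>(g, k, l)\<leftarrow>ts. S k l g) + (\<Sum>(g, k, l)\<leftarrow>ts. S l g k)"
      for S :: "('v \<Rightarrow> 'k) \<Rightarrow> ('v \<Rightarrow> 'k) \<Rightarrow> ('v \<Rightarrow> 'k) \<Rightarrow> 'k"
      by (simp add: ts'_def o_def case_prod_unfold)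
    have ts_eval: "(\<Sum>(g, k, l)\<leftarrow>ts. g x * k y * l z) = f (br x (br y z))" for x y z
    proof -
      have "(\<Sum>(g, k, l)\<leftarrow>ts. g x * k y * l z) = (\<Sum>(g, h)\<leftarrow>R f. \<Sum>(k, l)\<leftarrow>R h. g x * k y * l z)"
        by (rule sum_ts)
      also have "\<dots> = (\<Sum>(g, h)\<leftarrow>R f. g x * h (br y z))"
        using R[OF f]
        by (intro arg_cong[of _ _ sum_list] map_cong)
           (auto simp: R_br case_prod_unfold sum_list_const_mult mult.assoc)
      finally show ?thesis by (simp add: R_br f)
    qed
    have "(\<Sum>(g, k, l)\<leftarrow>ts'. T g k l) = 0"
    proof (rule trilinear_sum_eq_0[OF V_sub _ T])
      show "set ts' \<subseteq> V \<times> V \<times> V" using ts_V by (auto simp: ts'_def)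
      fix x y z
      have "(\<Sum>(g, k, l)\<leftarrow>ts'. g x * k y * l z) =
          f (br x (br y z)) + f (br z (br x y)) + f (br y (br z x))"
        unfolding sum_ts' using ts_eval[of x y z] ts_eval[of z x y] ts_eval[of y z x]
        by (simp add: ac_simps)
      also have "\<dots> = f (br x (br y z) + br y (br z x) + br z (br x y))"
        by (simp add: dual_spaceD(1)[OF V_dual[OF f]])
      also have "\<dots> = 0"
        using lie_algebra_onD(7)[OF lie, of x y z] dual_spaceD(5)[OF V_dual[OF f]] by simp
      finally show "(\<Sum>(g, k, l)\<leftarrow>ts'. g x * k y * l z) = 0" .
    qed
    moreover have "D f (\<lambda>u v. D v (\<lambda>a b. T a b u)) = (\<Sum>(g, k, l)\<leftarrow>ts. T k l g)"
      by (rule double[OF trilinear_form_rotate[OF T]])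
    moreover have "D f (\<lambda>u v. D v (\<lambda>a b. T b u a)) = (\<Sum>(g, k, l)\<leftarrow>ts. T l g k)"
      using double[OF trilinear_form_rotate[OF trilinear_form_rotate[OF T]]] .
    ultimately show ?thesis using double[OF T] unfolding sum_ts' by simp
  qed

  have D_cocycle: "D (?b f h) = act fun_scale V ?b f (D h) - act fun_scale V ?b h (D f)"
    if f: "f \<in> V" and h: "h \<in> V" for f h
  proof (rule eqI)
    note fh = closed[OF f h]
    show "D (?b f h) \<in> tensor_square fun_scale V" by (rule D_tens[OF fh])
    show "act fun_scale V ?b f (D h) - act fun_scale V ?b h (D f) \<in> tensor_square fun_scale V"
      by (intro fs.subspace_diff[OF tens_sub] act_in_tensor_square[OF lie_algebra_dual] f h D_tens)
    fix \<xi> \<eta>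
    \<comment> \<open>Since \<open>D h\<close> represents \<open>(\<xi>, \<eta>) \<mapsto> h [\<xi>, \<eta>]\<close>, applying \<open>[f, \<cdot>]\<close> to one factor of \<open>D h\<close> gives the
        value of \<open>\<delta>\<close> on a single pure tensor.\<close>
    have act_eval: "form_of_tensor (act fun_scale V ?b f (D h)) \<xi> \<eta> =
        \<delta> \<xi> (form_tens f (\<lambda>c. h (br c \<eta>))) + \<delta> \<eta> (form_tens f (\<lambda>c. h (br \<xi> c)))"
      if f: "f \<in> V" and h: "h \<in> V" for f h
    proof -
      have split: "(\<Sum>(v, w)\<leftarrow>R h. ?b f v \<xi> * w \<eta>) = \<delta> \<xi> (form_tens f (\<lambda>c. h (br c \<eta>)))"
      proof -
        have "\<delta> \<xi> (\<lambda>a c. \<Sum>p\<leftarrow>R h. snd p \<eta> * form_tens f (fst p) a c)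
            = (\<Sum>p\<leftarrow>R h. \<delta> \<xi> (\<lambda>a c. snd p \<eta> * form_tens f (fst p) a c))"
          using R[OF h] f V_dual
          by (intro tensor_square_sum_list[OF \<delta>_tens, THEN conjunct1] bilinear_form_on_scale bilinear_form_tens) auto
        also have "\<dots> = (\<Sum>p\<leftarrow>R h. snd p \<eta> * \<delta> \<xi> (form_tens f (fst p)))"
          using R[OF h] f V_dual
          by (intro arg_cong[of _ _ sum_list] map_cong tensor_square_scale[OF \<delta>_tens] bilinear_form_tens) auto
        finally have 1: "\<delta> \<xi> (\<lambda>a c. \<Sum>p\<leftarrow>R h. snd p \<eta> * form_tens f (fst p) a c)
            = (\<Sum>p\<leftarrow>R h. snd p \<eta> * \<delta> \<xi> (form_tens f (fst p)))" .
        have 2: "form_tens f (\<lambda>c. h (br c \<eta>)) = (\<lambda>a c. \<Sum>p\<leftarrow>R h. snd p \<eta> * form_tens f (fst p) a c)"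
          by (auto simp: fun_eq_iff form_tens_def R_br[OF h] sum_list_const_mult[symmetric]
              case_prod_unfold ac_simps)
        show ?thesis unfolding 2 1 by (simp add: dual_bracket_def case_prod_unfold mult.commute)
      qed
      have split': "(\<Sum>(v, w)\<leftarrow>R h. v \<xi> * ?b f w \<eta>) = \<delta> \<eta> (form_tens f (\<lambda>c. h (br \<xi> c)))"
      proof -
        have "\<delta> \<eta> (\<lambda>a c. \<Sum>p\<leftarrow>R h. fst p \<xi> * form_tens f (snd p) a c)
            = (\<Sum>p\<leftarrow>R h. \<delta> \<eta> (\<lambda>a c. fst p \<xi> * form_tens f (snd p) a c))"
          using R[OF h] f V_dual
          by (intro tensor_square_sum_list[OF \<delta>_tens, THEN conjunct1] bilinear_form_on_scale bilinear_form_tens) auto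
        also have "\<dots> = (\<Sum>p\<leftarrow>R h. fst p \<xi> * \<delta> \<eta> (form_tens f (snd p)))"
          using R[OF h] f V_dual
          by (intro arg_cong[of _ _ sum_list] map_cong tensor_square_scale[OF \<delta>_tens] bilinear_form_tens) auto
        finally have 1: "\<delta> \<eta> (\<lambda>a c. \<Sum>p\<leftarrow>R h. fst p \<xi> * form_tens f (snd p) a c)
            = (\<Sum>p\<leftarrow>R h. fst p \<xi> * \<delta> \<eta> (form_tens f (snd p)))" .
        have 2: "form_tens f (\<lambda>c. h (br \<xi> c)) = (\<lambda>a c. \<Sum>p\<leftarrow>R h. fst p \<xi> * form_tens f (snd p) a c)"
          by (auto simp: fun_eq_iff form_tens_def R_br[OF h] sum_list_const_mult[symmetric]
              case_prod_unfold ac_simps)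
        show ?thesis unfolding 2 1 by (simp add: dual_bracket_def case_prod_unfold)
      qed
      have "form_of_tensor (act fun_scale V ?b f (D h)) \<xi> \<eta> = D h (\<lambda>v w. ?b f v \<xi> * w \<eta> + v \<xi> * ?b f w \<eta>)"
        unfolding form_of_tensor_def act_def using bilinear_form_on_eval[of V \<xi> \<eta>] by simp
      also have "\<dots> = (\<Sum>(v, w)\<leftarrow>R h. ?b f v \<xi> * w \<eta> + v \<xi> * ?b f w \<eta>)"
        by (rule D_apply[OF bilinear_form_on_act(3)[OF lie_algebra_dual f bilinear_form_on_eval]])
      also have "\<dots> = (\<Sum>(v, w)\<leftarrow>R h. ?b f v \<xi> * w \<eta>) + (\<Sum>(v, w)\<leftarrow>R h. v \<xi> * ?b f w \<eta>)"
        by (simp add: case_prod_unfold sum_list_addf)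
      finally show ?thesis unfolding split split' .
    qed
    note bf = bilinear_form_tens dual_ad V_dual f h
    have skew: "\<delta> x (form_tens g k) = - \<delta> x (form_tens k g)"
      if "g \<in> dual_space s" "k \<in> dual_space s" for x g k
      using \<delta>_skew[OF bilinear_form_tens[OF that(2,1)], of x]
      by (simp add: form_tens_def mult.commute)
    have neg: "\<delta> x (form_tens g (\<lambda>c. k (br c y))) = - \<delta> x (form_tens g (\<lambda>c. k (br y c)))"
      if "g \<in> V" "k \<in> V" for x y g k
    proof -
      have "form_tens g (\<lambda>c. k (br c y)) = (\<lambda>v w. - form_tens g (\<lambda>c. k (br y c)) v w)"
        using dual_spaceD(3)[OF V_dual[OF that(2)]] br_skew[of _ y]
        by (auto simp: form_tens_def fun_eq_iff)
      then show ?thesis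
        using tensor_square_minus[OF \<delta>_tens bilinear_form_tens[OF V_dual[OF that(1)] dual_ad(1)[OF V_dual[OF that(2)]]]]
        by simp
    qed
    have act\<delta>: "act s UNIV br x (\<delta> y) (form_tens f h)
        = \<delta> y (form_tens (\<lambda>v. f (br x v)) h) + \<delta> y (form_tens f (\<lambda>v. h (br x v)))" for x y
    proof -
      have "act s UNIV br x (\<delta> y) (form_tens f h)
        = \<delta> y (\<lambda>v w. form_tens (\<lambda>v. f (br x v)) h v w + form_tens f (\<lambda>v. h (br x v)) v w)"
        using bilinear_form_tens[OF V_dual[OF f] V_dual[OF h]] by (simp add: act_def form_tens_def)
      then show ?thesis
        by (simp add: tensor_square_add[OF \<delta>_tens] bf)
    qed
    have "form_of_tensor (D (?b f h)) \<xi> \<eta> = \<delta> (br \<xi> \<eta>) (form_tens f h)"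
      by (simp add: form_D[OF fh]) (simp add: dual_bracket_def)
    also have "\<dots> = \<delta> \<eta> (form_tens (\<lambda>v. f (br \<xi> v)) h) + \<delta> \<eta> (form_tens f (\<lambda>v. h (br \<xi> v)))
        - (\<delta> \<xi> (form_tens (\<lambda>v. f (br \<eta> v)) h) + \<delta> \<xi> (form_tens f (\<lambda>v. h (br \<eta> v))))"
      by (simp add: \<delta>_cocycle act\<delta>)
    also have "\<dots> = form_of_tensor (act fun_scale V ?b f (D h)) \<xi> \<eta>
        - form_of_tensor (act fun_scale V ?b h (D f)) \<xi> \<eta>"
      unfolding act_eval[OF f h] act_eval[OF h f] neg[OF f h] neg[OF h f]
      using skew[OF dual_ad(1)[OF V_dual[OF f]] V_dual[OF h]] by simp
    finally show "form_of_tensor (D (?b f h)) \<xi> \<eta>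
        = form_of_tensor (act fun_scale V ?b f (D h) - act fun_scale V ?b h (D f)) \<xi> \<eta>"
      by (simp add: form_of_tensor_diff)
  qed

  have "lie_bialgebra_on fun_scale V ?b D"
    unfolding lie_bialgebra_on_def lie_cobracket_on_def
    using lie_algebra_dual D_tens D_lin D_skew D_jacobi D_cocycle by blast
  moreover have "form_of_tensor (D f) = dual_cobracket br f" if "f \<in> V" for f
    using form_D[OF that] by (auto simp: dual_cobracket_def fun_eq_iff)
  ultimately show ?thesis by blast
qed

end

section \<open>Triangular structures on two-dimensional subalgebras\<close>

text \<open>The triangular structure on a Lie algebra given by a wedge \<open>a \<otimes> b - b \<otimes> a\<close> with \<open>[a, b] = c b\<close>.\<close>

context
  fixes s :: "'k::field \<Rightarrow> 'v::ab_group_add \<Rightarrow> 'v"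
    and br :: "'v \<Rightarrow> 'v \<Rightarrow> 'v" and a b :: 'v and c :: 'k and r :: "('k, 'v) tensor"
  assumes lie: "lie_algebra_on s UNIV br"
    and ab: "br a b = s c b"
    and r: "r = tens s UNIV a b - tens s UNIV b a"
begin

private lemma wedge_vs: "vector_space s" using lie_algebra_onD(1)[OF lie] .

interpretation vector_space s by (rule wedge_vs)

private lemma wedge_br_add: "br x (y + z) = br x y + br x z" "br (x + y) z = br x z + br y z"
  and wedge_br_scale: "br x (s d y) = s d (br x y)" "br (s d x) y = s d (br x y)"
  and wedge_br_same: "br x x = 0"
  using lie by (simp_all add: lie_algebra_on_def bilinear_on_def linear_on_def)

private lemma ba: "br b a = s (- c) b"
  using lie_algebra_skew[OF lie, of a b] ab by simp

private lemma r_apply: "bilinear_form_on s UNIV B \<Longrightarrow> r B = B a b - B b a"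
  by (simp add: r tens_def)

private lemma r_tens: "r \<in> tensor_square s UNIV"
  unfolding r tensor_square_def by (intro fs.span_diff fs.span_base) blast+

private lemma wedge_cybe: "cybe s UNIV br r"
  unfolding cybe_def
proof (intro allI impI)
  fix T assume T: "trilinear_form_on s UNIV T"
  have lin: "T (x + x') y z = T x y z + T x' y z" "T x (y + y') z = T x y z + T x y' z"
    "T x y (z + z') = T x y z + T x y z'"
    "T (s d x) y z = d * T x y z" "T x (s d y) z = d * T x y z" "T x y (s d z) = d * T x y z"
    for x x' y y' z z' d
    using T by (simp_all add: trilinear_on_def bilinear_on_def linear_on_def)
  have zero: "T 0 y z = 0" "T x 0 z = 0" "T x y 0 = 0" for x y z
    using lin(4)[of 0 0 y z] lin(5)[of x 0 0 z] lin(6)[of x y 0 0] by simp_all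
  have inner: "r (\<lambda>v w. T (br x v) y w) = T (br x a) y b - T (br x b) y a"
    "r (\<lambda>v w. T x (br y v) w) = T x (br y a) b - T x (br y b) a"
    "r (\<lambda>v w. T x v (br y w)) = T x a (br y b) - T x b (br y a)" for x y
    using r_apply[of "\<lambda>v w. T (br x v) y w"] r_apply[of "\<lambda>v w. T x (br y v) w"]
      r_apply[of "\<lambda>v w. T x v (br y w)"]
    by (simp_all add: bilinear_on_def linear_on_def lin wedge_br_add wedge_br_scale)
  have outer: "r (\<lambda>x y. T (br x a) y b - T (br x b) y a) =
      (T (br a a) b b - T (br a b) b a) - (T (br b a) a b - T (br b b) a a)"
    "r (\<lambda>x y. T x (br y a) b - T x (br y b) a) =
      (T a (br b a) b - T a (br b b) a) - (T b (br a a) b - T b (br a b) a)"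
    "r (\<lambda>x y. T x a (br y b) - T x b (br y a)) =
      (T a a (br b b) - T a b (br b a)) - (T b a (br a b) - T b b (br a a))"
    using r_apply[of "\<lambda>x y. T (br x a) y b - T (br x b) y a"]
      r_apply[of "\<lambda>x y. T x (br y a) b - T x (br y b) a"]
      r_apply[of "\<lambda>x y. T x a (br y b) - T x b (br y a)"]
    by (simp_all add: bilinear_on_def linear_on_def lin wedge_br_add wedge_br_scale algebra_simps)
  show "r (\<lambda>x y. r (\<lambda>v w. T (br x v) y w)) + r (\<lambda>x y. r (\<lambda>v w. T x (br y v) w))
      + r (\<lambda>x y. r (\<lambda>v w. T x v (br y w))) = 0"
    unfolding inner outer by (simp add: ab ba wedge_br_same lin zero del: scale_minus_left)
qed

private abbreviation (input) "\<delta> \<equiv> coboundary s UNIV br r"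

lemma wedge_coboundary_apply:
  assumes "bilinear_form_on s UNIV B"
  shows "\<delta> x B = B (br x a) b + B a (br x b) - B (br x b) a - B b (br x a)"
  using assms r_apply[OF bilinear_form_on_act(3)[OF lie _ assms, of x]]
  by (simp add: coboundary_def act_def)

private lemma wedge_tens: "\<delta> x \<in> tensor_square s UNIV"
  unfolding coboundary_def by (rule act_in_tensor_square[OF lie _ r_tens]) simp

private lemma wedge_off: "\<not> bilinear_form_on s UNIV B \<Longrightarrow> \<delta> x B = 0"
  by (rule tensor_square_off[OF wedge_tens])

private lemma wedge_lin: "linear_on s fun_scale UNIV \<delta>"
  unfolding linear_on_def
proof (intro conjI ballI allI ext)
  fix x y B d
  show "\<delta> (x + y) B = (\<delta> x + \<delta> y) B"
  proof (cases "bilinear_form_on s UNIV B")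
    case True
    have "B (u + u') v = B u v + B u' v" "B v (u + u') = B v u + B v u'" for u u' v
      using True by (simp_all add: bilinear_on_def linear_on_def)
    then show ?thesis using True by (simp add: wedge_coboundary_apply wedge_br_add)
  qed (simp add: wedge_off)
  show "\<delta> (s d x) B = fun_scale d (\<delta> x) B"
  proof (cases "bilinear_form_on s UNIV B")
    case True
    have "B (s d u) v = d * B u v" "B v (s d u) = d * B v u" for u v
      using True by (simp_all add: bilinear_on_def linear_on_def)
    then show ?thesis using True by (simp add: wedge_coboundary_apply wedge_br_scale algebra_simps)
  qed (simp add: wedge_off)
qed

private lemma wedge_jacobi:
  assumes T: "trilinear_form_on s UNIV T"
  shows "\<delta> x (\<lambda>u v. \<delta> v (\<lambda>a b. T u a b)) + \<delta> x (\<lambda>u v. \<delta> v (\<lambda>a b. T a b u))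
      + \<delta> x (\<lambda>u v. \<delta> v (\<lambda>a b. T b u a)) = 0"
proof -
  define y where "y = br x a"
  define z where "z = br x b"
  define p where "p = br y b"
  \<comment> \<open>The Jacobi identity for \<open>x, a, b\<close>.\<close>
  have za: "br z a = p + s (- c) z"
  proof -
    have "br z a = br x (br b a) - br b y"
      unfolding y_def z_def by (rule lie_algebra_leibniz[OF lie UNIV_I UNIV_I UNIV_I])
    also have "\<dots> = s (- c) z + p"
      using lie_algebra_skew[OF lie, of y b] unfolding ba wedge_br_scale by (simp add: z_def p_def)
    finally show ?thesis by (simp only: add.commute)
  qed
  have nested: "\<delta> x (\<lambda>u v. \<delta> v (S u)) =
      (S y (br b a) b + S y a (br b b) - S y (br b b) a - S y b (br b a))
      + (S a (br z a) b + S a a (br z b) - S a (br z b) a - S a b (br z a))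
      - (S z (br a a) b + S z a (br a b) - S z (br a b) a - S z b (br a a))
      - (S b (br y a) b + S b a (br y b) - S b (br y b) a - S b b (br y a))"
    if S: "trilinear_form_on s UNIV S" for S
  proof -
    have B: "bilinear_form_on s UNIV (S u)" for u using S by (simp add: trilinear_on_def)
    show ?thesis
      using wedge_coboundary_apply[OF bilinear_form_on_cobracket[OF wedge_vs subspace_UNIV wedge_tens wedge_lin S], of x]
      unfolding wedge_coboundary_apply[OF B] y_def z_def by simp
  qed
  have lin: "T (x + x') y z = T x y z + T x' y z" "T x (y + y') z = T x y z + T x y' z"
    "T x y (z + z') = T x y z + T x y z'"
    "T (s d x) y z = d * T x y z" "T x (s d y) z = d * T x y z" "T x y (s d z) = d * T x y z"
    for x x' y y' z z' d
    using T by (simp_all add: trilinear_on_def bilinear_on_def linear_on_def)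
  have zero: "T 0 y z = 0" "T x 0 z = 0" "T x y 0 = 0" for x y z
    using lin(4)[of 0 0 y z] lin(5)[of x 0 0 z] lin(6)[of x y 0 0] by simp_all
  note rot = trilinear_form_rotate[OF T]
  show ?thesis
    unfolding nested[OF T] nested[OF rot] nested[OF trilinear_form_rotate[OF rot]]
    by (simp add: ab ba wedge_br_same za p_def[symmetric] lin zero algebra_simps del: scale_minus_left)
qed

private lemma wedge_cocycle: "\<delta> (br x y) = act s UNIV br x (\<delta> y) - act s UNIV br y (\<delta> x)"
proof
  fix B
  show "\<delta> (br x y) B = (act s UNIV br x (\<delta> y) - act s UNIV br y (\<delta> x)) B"
  proof (cases "bilinear_form_on s UNIV B")
    case True
    have lin: "B (u - u') v = B u v - B u' v" "B v (u - u') = B v u - B v u'" for u u' v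
    proof -
      have "B (u - u' + u') v = B (u - u') v + B u' v" "B v (u - u' + u') = B v (u - u') + B v u'"
        using True unfolding bilinear_on_def linear_on_def by blast+
      then show "B (u - u') v = B u v - B u' v" "B v (u - u') = B v u - B v u'" by simp_all
    qed
    have leibniz: "br (br x y) v = br x (br y v) - br y (br x v)" for v
      using lie_algebra_leibniz[OF lie] by blast
    have "act s UNIV br v (\<delta> w) B = \<delta> w (\<lambda>p q. B (br v p) q + B p (br v q))" for v w
      using True by (simp add: act_def)
    then show ?thesis
      using True by (simp add: wedge_coboundary_apply bilinear_form_on_act(3)[OF lie] leibniz lin)
  next
    case False
    then show ?thesis by (simp add: wedge_off act_def)
  qed
qed

text \<open>If \<open>[a, b]\<close> is a multiple of \<open>b\<close>, then \<open>a \<otimes> b - b \<otimes> a\<close> solves the classical Yang-Baxter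
  equation, and its coboundary is a Lie bialgebra structure.\<close>

lemma wedge_coboundary_triangular: "coboundary_triangular s UNIV br r"
proof -
  have "\<delta> x (\<lambda>v w. B w v) = - \<delta> x B" if B: "bilinear_form_on s UNIV B" for x B
    using wedge_coboundary_apply[OF B] wedge_coboundary_apply[OF bilinear_form_on_swap[THEN iffD2, OF B]]
    by simp
  then have "lie_cobracket_on s UNIV \<delta>"
    unfolding lie_cobracket_on_def using wedge_tens wedge_lin wedge_jacobi by blast
  then show ?thesis
    unfolding coboundary_triangular_def lie_bialgebra_on_def
    using r_tens wedge_cybe lie wedge_cocycle by blast
qed

lemma wedge_dual_bracket:
  assumes "f \<in> dual_space s" "h \<in> dual_space s"
  shows "dual_bracket \<delta> f h \<xi> = f (br \<xi> a) * h b + f a * h (br \<xi> b) - f (br \<xi> b) * h a - f b * h (br \<xi> a)"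
  unfolding dual_bracket_def wedge_coboundary_apply[OF bilinear_form_tens[OF assms]]
  by (simp add: form_tens_def)

end

text \<open>Goodness writes \<open>f [\<xi>, \<eta>]\<close> as a finite sum of products \<open>g \<xi> * h \<eta>\<close>; for fixed \<open>\<eta>\<close> this is a
  linear combination of the \<open>g\<close>.\<close>

lemma good_subspace_coadjoint:
  assumes "good_subspace s br U" "f \<in> U"
  shows "(\<lambda>\<xi>. f (br \<xi> y)) \<in> U"
proof -
  have U: "fs.subspace U" using assms by (simp add: good_subspace_def)
  have "dual_cobracket br f \<in> fs2.span {form_tens f h | f h. f \<in> U \<and> h \<in> U}"
    using assms unfolding good_subspace_def by blast
  from form_tens_span[OF this U] obtain ps where ps: "set ps \<subseteq> U \<times> U"
    "\<And>\<xi> \<eta>. f (br \<xi> \<eta>) = (\<Sum>(g, h)\<leftarrow>ps. g \<xi> * h \<eta>)"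
    unfolding dual_cobracket_def by blast
  have "(\<lambda>\<xi>. \<Sum>(g, h)\<leftarrow>ps. g \<xi> * h y) \<in> U" using ps(1)
  proof (induction ps)
    case Nil
    have "(\<lambda>_. 0) = (0 :: 'b \<Rightarrow> 'a)" by (auto simp: fun_eq_iff)
    then show ?case using fs.subspace_0[OF U] by simp
  next
    case (Cons p ps)
    obtain g h where p: "p = (g, h)" by (cases p)
    have "(\<lambda>\<xi>. \<Sum>(g, h)\<leftarrow>p # ps. g \<xi> * h y) = fun_scale (h y) g + (\<lambda>\<xi>. \<Sum>(g, h)\<leftarrow>ps. g \<xi> * h y)"
      by (auto simp: p fun_eq_iff mult.commute)
    moreover have "g \<in> U" using Cons.prems p by auto
    ultimately show ?case using Cons fs.subspace_add[OF U] fs.subspace_scale[OF U] by simp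
  qed
  then show ?thesis by (simp add: ps(2))
qed

lemma wedge_dual_bracket_closed:
  assumes "lie_algebra_on s UNIV br" "br a b = s c b" "good_subspace s br U" "f \<in> U" "h \<in> U"
  shows "dual_bracket (coboundary s UNIV br (tens s UNIV a b - tens s UNIV b a)) f h \<in> U"
proof -
  have U: "fs.subspace U" and dual: "f \<in> dual_space s" "h \<in> dual_space s"
    using assms by (auto simp: good_subspace_def)
  have "dual_bracket (coboundary s UNIV br (tens s UNIV a b - tens s UNIV b a)) f h
      = fun_scale (h b) (\<lambda>\<xi>. f (br \<xi> a)) + fun_scale (f a) (\<lambda>\<xi>. h (br \<xi> b))
      - fun_scale (h a) (\<lambda>\<xi>. f (br \<xi> b)) - fun_scale (f b) (\<lambda>\<xi>. h (br \<xi> a))"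
    using wedge_dual_bracket[OF assms(1,2) refl dual] by (auto simp: fun_eq_iff)
  also have "\<dots> \<in> U"
    by (intro fs.subspace_diff[OF U] fs.subspace_add[OF U] fs.subspace_scale[OF U]
        good_subspace_coadjoint[OF assms(3)] assms)
  finally show ?thesis .
qed

section \<open>Laurent polynomials\<close>

lemma laurent_sum_monomials:
  fixes f :: "'a \<Rightarrow>\<^sub>0 'b::comm_monoid_add"
  assumes "finite A" "Poly_Mapping.keys f \<subseteq> A"
  shows "f = (\<Sum>k\<in>A. Poly_Mapping.single k (Poly_Mapping.lookup f k))"
proof (rule poly_mapping_eqI)
  fix n
  show "Poly_Mapping.lookup f n = Poly_Mapping.lookup (\<Sum>k\<in>A. Poly_Mapping.single k (Poly_Mapping.lookup f k)) n"
    using assms by (auto simp: lookup_sum lookup_single when_def in_keys_iff)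
qed

lemma laurent_induct [case_names zero monom add]:
  fixes f :: "'a \<Rightarrow>\<^sub>0 'b::comm_monoid_add"
  assumes "P 0" "\<And>k c. P (Poly_Mapping.single k c)" "\<And>f g. P f \<Longrightarrow> P g \<Longrightarrow> P (f + g)"
  shows "P f"
proof -
  have "P (\<Sum>k\<in>A. Poly_Mapping.single k (Poly_Mapping.lookup f k))" if "finite A" for A
    using that by induction (simp_all add: assms)
  then show ?thesis by (subst laurent_sum_monomials[OF finite_keys order_refl]) simp
qed

lemma lookup_single_mult:
  fixes q :: "'k::field laurent"
  shows "Poly_Mapping.lookup (Poly_Mapping.single k c * q) n = c * Poly_Mapping.lookup q (n - k)"
  by (induction q rule: laurent_induct)
     (auto simp: mult_single lookup_single when_def lookup_add algebra_simps)

lemma lookup_mult_finite: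
  fixes p q :: "'k::field laurent"
  assumes "finite A" "Poly_Mapping.keys p \<subseteq> A"
  shows "Poly_Mapping.lookup (p * q) n = (\<Sum>k\<in>A. Poly_Mapping.lookup p k * Poly_Mapping.lookup q (n - k))"
  by (subst laurent_sum_monomials[OF assms])
     (simp add: sum_distrib_right lookup_sum lookup_single_mult)

lemma lookup_mult_top:
  fixes p q :: "'k::field laurent"
  assumes "\<And>k. k > d \<Longrightarrow> Poly_Mapping.lookup p k = 0" "\<And>k. k > e \<Longrightarrow> Poly_Mapping.lookup q k = 0"
  shows "Poly_Mapping.lookup (p * q) (d + e) = Poly_Mapping.lookup p d * Poly_Mapping.lookup q e"
proof -
  have "Poly_Mapping.lookup (p * q) (d + e)
      = (\<Sum>k\<in>insert d (Poly_Mapping.keys p). Poly_Mapping.lookup p k * Poly_Mapping.lookup q (d + e - k))"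
    by (rule lookup_mult_finite) auto
  also have "\<dots> = (\<Sum>k\<in>{d}. Poly_Mapping.lookup p k * Poly_Mapping.lookup q (d + e - k))"
  proof (rule sum.mono_neutral_right)
    show "\<forall>i\<in>insert d (Poly_Mapping.keys p) - {d}. Poly_Mapping.lookup p i * Poly_Mapping.lookup q (d + e - i) = 0"
    proof
      fix i assume "i \<in> insert d (Poly_Mapping.keys p) - {d}"
      then consider "i > d" | "d + e - i > e" by fastforce
      then show "Poly_Mapping.lookup p i * Poly_Mapping.lookup q (d + e - i) = 0"
        using assms by cases simp_all
    qed
  qed auto
  finally show ?thesis by simp
qed

lemma lookup_laurent_scale: "Poly_Mapping.lookup (laurent_scale c f) n = c * Poly_Mapping.lookup f n"
  by (simp add: laurent_scale_def map.rep_eq when_def)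

lemma laurent_scale_conv_mult: "laurent_scale c f = Poly_Mapping.single 0 c * f"
  by (rule poly_mapping_eqI) (simp add: lookup_laurent_scale lookup_single_mult)

lemma laurent_scale_mult:
  "p * laurent_scale c f = laurent_scale c (p * f)" "laurent_scale c f * p = laurent_scale c (f * p)"
  by (simp_all add: laurent_scale_conv_mult ac_simps)

lemma laurent_scale_diff: "laurent_scale c (f - g) = laurent_scale c f - laurent_scale c g"
  by (simp add: laurent_scale_conv_mult right_diff_distrib)

lemma lookup_laurent_deriv:
  "Poly_Mapping.lookup (laurent_deriv f) n = of_int (n + 1) * Poly_Mapping.lookup f (n + 1)"
proof -
  have "Poly_Mapping.lookup (laurent_deriv f) n =
      (\<Sum>k\<in>Poly_Mapping.keys f. if k = n + 1 then of_int (n + 1) * Poly_Mapping.lookup f (n + 1) else 0)"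
    unfolding laurent_deriv_def lookup_sum by (rule sum.cong) (auto simp: lookup_single when_def)
  then show ?thesis by (auto simp: in_keys_iff)
qed

lemma laurent_deriv_add: "laurent_deriv (f + g) = laurent_deriv f + laurent_deriv g"
  by (rule poly_mapping_eqI) (simp add: lookup_laurent_deriv lookup_add algebra_simps)

lemma laurent_deriv_diff: "laurent_deriv (f - g) = laurent_deriv f - laurent_deriv g"
  by (rule poly_mapping_eqI) (simp add: lookup_laurent_deriv lookup_minus algebra_simps)

lemma laurent_deriv_0 [simp]: "laurent_deriv 0 = 0"
  by (simp add: laurent_deriv_def)

lemma laurent_deriv_mult: "laurent_deriv (f * g) = f * laurent_deriv g + laurent_deriv f * g"
proof (induction f rule: laurent_induct)
  case (monom k c)
  show ?case
    by (induction g rule: laurent_induct)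
       (simp_all add: mult_single laurent_deriv_add distrib_left single_add[symmetric] algebra_simps)
qed (simp_all add: laurent_deriv_add distrib_right)

lemma laurent_deriv_scale: "laurent_deriv (laurent_scale c f) = laurent_scale c (laurent_deriv f)"
  by (rule poly_mapping_eqI) (simp add: lookup_laurent_deriv lookup_laurent_scale)

lemma vector_space_laurent: "vector_space laurent_scale"
  by unfold_locales
     (rule poly_mapping_eqI, simp add: lookup_laurent_scale lookup_add algebra_simps)+

lemma vector_space_hv: "vector_space hv_scale"
proof -
  interpret vector_space laurent_scale by (rule vector_space_laurent)
  show ?thesis
    by unfold_locales
       (simp_all add: hv_scale_def prod_eq_iff scale_right_distrib scale_left_distrib)
qed

lemma hv_lie_algebra: "lie_algebra_on hv_scale UNIV hv_bracket"
proof -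
  interpret vector_space hv_scale by (rule vector_space_hv)
  have "bilinear_on hv_scale hv_scale UNIV hv_bracket"
    by (auto simp: bilinear_on_def linear_on_def hv_bracket_def hv_scale_def laurent_deriv_add
        laurent_deriv_scale laurent_scale_mult laurent_scale_diff distrib_left distrib_right)
  moreover have "hv_bracket x (hv_bracket y z) + hv_bracket y (hv_bracket z x) + hv_bracket z (hv_bracket x y) = 0"
    for x y z :: "'a hv"
    by (simp add: hv_bracket_def prod_eq_iff laurent_deriv_diff laurent_deriv_mult algebra_simps)
  moreover have "hv_bracket x x = 0" for x :: "'a hv"
    by (simp add: hv_bracket_def prod_eq_iff)
  ultimately show ?thesis
    unfolding lie_algebra_on_def using vector_space_hv by auto
qed

section \<open>Linearly recursive functionals\<close>

lemma laurent_dual_expand: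
  assumes f: "f \<in> dual_space laurent_scale" and A: "finite A" "Poly_Mapping.keys u \<subseteq> A"
  shows "f u = (\<Sum>k\<in>A. Poly_Mapping.lookup u k * f (xpow k))"
proof -
  interpret vector_space laurent_scale by (rule vector_space_laurent)
  have "f (\<Sum>k\<in>A. g k) = (\<Sum>k\<in>A. f (g k))" for g :: "int \<Rightarrow> 'a laurent"
    using A(1) by induction (simp_all add: dual_spaceD[OF f])
  moreover have "f (Poly_Mapping.single k c) = c * f (xpow k)" for k c
  proof -
    have "Poly_Mapping.single k c = laurent_scale c (xpow k)"
      by (simp add: laurent_scale_conv_mult xpow_def mult_single)
    then show ?thesis by (simp add: dual_spaceD[OF f])
  qed
  moreover have "f u = f (\<Sum>k\<in>A. Poly_Mapping.single k (Poly_Mapping.lookup u k))"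
    by (rule arg_cong[OF laurent_sum_monomials[OF A]])
  ultimately show ?thesis by simp
qed

lemma laurent_dual_mult:
  assumes "f \<in> dual_space laurent_scale"
  shows "(\<lambda>u. f (p * u)) \<in> dual_space laurent_scale"
  using assms
  by (intro dual_spaceI vector_space_laurent)
     (auto simp: dual_spaceD distrib_left laurent_scale_mult)

text \<open>The dual space of the Laurent polynomials is a module over them, and the linearly recursive
  functionals are its torsion elements.\<close>

lemma laurent_circ_iff:
  "f \<in> laurent_circ \<longleftrightarrow> f \<in> dual_space laurent_scale \<and> (\<exists>q. q \<noteq> 0 \<and> (\<forall>u. f (q * u) = 0))"
proof (intro iffI conjI)
  assume "f \<in> laurent_circ"
  then show f: "f \<in> dual_space laurent_scale" by (simp add: laurent_circ_def)
  from \<open>f \<in> laurent_circ\<close> obtain r :: nat and c where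
    rec: "f (xpow n) = (\<Sum>j=1..r. c j * f (xpow (n - int j)))" for n
    by (auto simp: laurent_circ_def)
  define q where "q = 1 - (\<Sum>j=1..r. Poly_Mapping.single (- int j) (c j))"
  have "Poly_Mapping.lookup q 0 = 1"
    by (simp add: q_def lookup_minus lookup_sum lookup_single when_def)
  then have "q \<noteq> 0" by auto
  moreover have "f (q * u) = 0" for u
  proof -
    have sum: "f (\<Sum>k\<in>A. g k) = (\<Sum>k\<in>A. f (g k))" if "finite A" for A and g :: "nat \<Rightarrow> 'a laurent"
      using that by induction (simp_all add: dual_spaceD[OF f])
    have "f (q * xpow n) = 0" for n
    proof -
      have "q * xpow n = xpow n - (\<Sum>j=1..r. laurent_scale (c j) (xpow (n - int j)))"
        by (simp add: q_def left_diff_distrib sum_distrib_right xpow_def mult_single laurent_scale_conv_mult)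
      then show ?thesis using rec[of n] by (simp add: dual_spaceD[OF f] sum)
    qed
    then show ?thesis
      using laurent_dual_expand[OF laurent_dual_mult[OF f, of q] finite_keys order_refl, of u] by simp
  qed
  ultimately show "\<exists>q. q \<noteq> 0 \<and> (\<forall>u. f (q * u) = 0)" by blast
next
  assume "f \<in> dual_space laurent_scale \<and> (\<exists>q. q \<noteq> 0 \<and> (\<forall>u. f (q * u) = 0))"
  then obtain q where f: "f \<in> dual_space laurent_scale" and q: "q \<noteq> 0" "\<And>u. f (q * u) = 0" by blast
  define N where "N = Max (Poly_Mapping.keys q)"
  define L where "L = Poly_Mapping.lookup q N"
  define r where "r = nat (N - Min (Poly_Mapping.keys q))"
  have ne: "Poly_Mapping.keys q \<noteq> {}" using q(1) by simp
  have "L \<noteq> 0" using Max_in[OF finite_keys ne] by (simp add: L_def N_def in_keys_iff)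
  have keys: "Poly_Mapping.keys q \<subseteq> (\<lambda>j. N - int j) ` {0..r}"
  proof
    fix k assume k: "k \<in> Poly_Mapping.keys q"
    then have "k \<le> N" "Min (Poly_Mapping.keys q) \<le> k" by (simp_all add: N_def)
    then show "k \<in> (\<lambda>j. N - int j) ` {0..r}"
      by (intro image_eqI[of _ _ "nat (N - k)"]) (auto simp: r_def)
  qed
  have "f (xpow n) = (\<Sum>j=1..r. (- Poly_Mapping.lookup q (N - int j) / L) * f (xpow (n - int j)))" for n
  proof -
    have shift: "f (xpow (n - N) * xpow k) = f (xpow (n - N + k))" for k
      by (simp add: xpow_def mult_single)
    have "0 = f (xpow (n - N) * q)" using q(2)[of "xpow (n - N)"] by (simp add: mult.commute)
    also have "\<dots> = (\<Sum>k\<in>(\<lambda>j. N - int j) ` {0..r}. Poly_Mapping.lookup q k * f (xpow (n - N) * xpow k))"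
      by (rule laurent_dual_expand[OF laurent_dual_mult[OF f]]) (use keys in auto)
    also have "\<dots> = (\<Sum>j=0..r. Poly_Mapping.lookup q (N - int j) * f (xpow (n - int j)))"
      unfolding shift by (subst sum.reindex) (auto simp: inj_on_def)
    also have "\<dots> = L * f (xpow n) + (\<Sum>j=1..r. Poly_Mapping.lookup q (N - int j) * f (xpow (n - int j)))"
      by (simp add: sum.atLeast_Suc_atMost L_def)
    finally have "f (xpow n) = - (\<Sum>j=1..r. Poly_Mapping.lookup q (N - int j) * f (xpow (n - int j))) / L"
      using \<open>L \<noteq> 0\<close> by (simp add: field_simps eq_neg_iff_add_eq_0)
    then show ?thesis by (simp add: sum_negf sum_divide_distrib)
  qed
  then have "\<exists>(r::nat) c. \<forall>n. f (xpow n) = (\<Sum>j=1..r. c j * f (xpow (n - int j)))"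
    by (intro exI[of _ r] exI[of _ "\<lambda>j. - Poly_Mapping.lookup q (N - int j) / L"] allI)
  with f show "f \<in> laurent_circ" unfolding laurent_circ_def by (intro CollectI conjI)
qed

lemma laurent_circ_dual: "f \<in> laurent_circ \<Longrightarrow> f \<in> dual_space laurent_scale"
  by (simp add: laurent_circ_iff)

lemma subspace_laurent_circ: "fs.subspace laurent_circ"
proof (rule fs.subspaceI)
  have "(0 :: 'a laurent \<Rightarrow> 'a) \<in> dual_space laurent_scale"
    by (rule dual_spaceI[OF vector_space_laurent]) auto
  then show "(0 :: 'a laurent \<Rightarrow> 'a) \<in> laurent_circ"
    unfolding laurent_circ_iff by (intro conjI exI[of _ 1]) auto
next
  fix f g :: "'a laurent \<Rightarrow> 'a" assume f: "f \<in> laurent_circ" and g: "g \<in> laurent_circ"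
  then obtain p q where pq: "p \<noteq> 0" "q \<noteq> 0" "\<And>u. f (p * u) = 0" "\<And>u. g (q * u) = 0"
    unfolding laurent_circ_iff by blast
  have "(f + g) (p * q * u) = 0" for u
    using pq(3)[of "q * u"] pq(4)[of "p * u"] by (simp add: ac_simps)
  moreover have "f + g \<in> dual_space laurent_scale"
    using f[THEN laurent_circ_dual] g[THEN laurent_circ_dual]
    by (intro dual_spaceI vector_space_laurent) (simp_all add: dual_spaceD algebra_simps)
  ultimately show "f + g \<in> laurent_circ"
    unfolding laurent_circ_iff using pq by (intro conjI exI[of _ "p * q"]) simp_all
next
  fix f :: "'a laurent \<Rightarrow> 'a" and c assume f: "f \<in> laurent_circ"
  moreover have "(\<lambda>x. c * f x) \<in> dual_space laurent_scale"
    using f[THEN laurent_circ_dual]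
    by (intro dual_spaceI vector_space_laurent) (simp_all add: dual_spaceD algebra_simps)
  ultimately show "fun_scale c f \<in> laurent_circ"
    unfolding laurent_circ_iff fun_scale_def by auto
qed

lemma laurent_circ_mult:
  assumes "f \<in> laurent_circ"
  shows "(\<lambda>u. f (p * u)) \<in> laurent_circ"
proof -
  obtain q where q: "q \<noteq> 0" "\<And>u. f (q * u) = 0" using assms unfolding laurent_circ_iff by blast
  have "f (p * (q * u)) = 0" for u using q(2)[of "p * u"] by (simp add: mult.left_commute)
  then show ?thesis
    using laurent_dual_mult[OF laurent_circ_dual[OF assms], of p] q(1) unfolding laurent_circ_iff by blast
qed

lemma laurent_circ_deriv:
  assumes "f \<in> laurent_circ"
  shows "(\<lambda>u. f (laurent_deriv u)) \<in> laurent_circ"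
proof -
  have f: "f \<in> dual_space laurent_scale" by (rule laurent_circ_dual[OF assms])
  obtain q where q: "q \<noteq> 0" "\<And>u. f (q * u) = 0" using assms unfolding laurent_circ_iff by blast
  \<comment> \<open>The derivative of a multiple of \<open>q\<^sup>2\<close> is a multiple of \<open>q\<close>.\<close>
  have "laurent_deriv (q * q * u) = q * (laurent_deriv q * u + laurent_deriv q * u + q * laurent_deriv u)" for u
    by (simp add: laurent_deriv_mult algebra_simps)
  then have "f (laurent_deriv (q * q * u)) = 0" for u by (simp add: q(2))
  moreover have "(\<lambda>u. f (laurent_deriv u)) \<in> dual_space laurent_scale"
    by (rule dual_spaceI[OF vector_space_laurent])
       (simp_all add: laurent_deriv_add laurent_deriv_scale dual_spaceD[OF f])
  ultimately show ?thesis unfolding laurent_circ_iff using q(1)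
    by (intro conjI exI[of _ "q * q"]) auto
qed

text \<open>The cyclic submodule generated by a linearly recursive functional is finite-dimensional.\<close>

lemma laurent_circ_finite_orbit:
  fixes f :: "'k::field laurent \<Rightarrow> 'k"
  assumes "f \<in> laurent_circ"
  obtains S where "finite S" "S \<subseteq> laurent_circ" "\<And>p. (\<lambda>u. f (p * u)) \<in> fs.span S"
proof -
  have f: "f \<in> dual_space laurent_scale" by (rule laurent_circ_dual[OF assms])
  obtain q where q: "q \<noteq> 0" "\<And>u. f (q * u) = 0" using assms unfolding laurent_circ_iff by blast
  define T where "T = (\<lambda>n u. f (xpow n * u))"
  have expand: "f (p * u) = (\<Sum>k\<in>Poly_Mapping.keys p. Poly_Mapping.lookup p k * T k u)" for p u
    using laurent_dual_expand[OF laurent_dual_mult[OF f, of u] finite_keys order_refl, of p]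
    by (simp add: T_def mult.commute)
  have sum_apply: "(\<Sum>k\<in>A. fun_scale (a k) (T (g k))) u = (\<Sum>k\<in>A. a k * T (g k) u)"
    if "finite A" for A :: "int set" and a g u
    using that by induction auto
  define a where "a = Min (Poly_Mapping.keys q)"
  define b where "b = Max (Poly_Mapping.keys q)"
  have ne: "Poly_Mapping.keys q \<noteq> {}" using q(1) by simp
  have ab: "a \<in> Poly_Mapping.keys q" "b \<in> Poly_Mapping.keys q"
    using Min_in[OF finite_keys ne] Max_in[OF finite_keys ne] by (simp_all add: a_def b_def)
  have bounds: "a \<le> k" "k \<le> b" if "k \<in> Poly_Mapping.keys q" for k
    using that by (simp_all add: a_def b_def)
  define S where "S = T ` {a..b}"
  \<comment> \<open>Any term of the relation \<open>q \<cdot> f = 0\<close> can be solved for.\<close>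
  have solve: "T (l + m) \<in> fs.span S"
    if l: "l \<in> Poly_Mapping.keys q"
      and rest: "\<And>k. k \<in> Poly_Mapping.keys q \<Longrightarrow> k \<noteq> l \<Longrightarrow> T (k + m) \<in> fs.span S" for l m
  proof -
    let ?c = "\<lambda>k. - (Poly_Mapping.lookup q k / Poly_Mapping.lookup q l)"
    let ?K = "Poly_Mapping.keys q - {l}"
    have "T (l + m) u = (\<Sum>k\<in>?K. ?c k * T (k + m) u)" for u
    proof -
      have shift: "T k (xpow m * u) = T (k + m) u" for k
        by (simp add: T_def xpow_def mult_single mult.assoc[symmetric])
      have "0 = (\<Sum>k\<in>Poly_Mapping.keys q. Poly_Mapping.lookup q k * T (k + m) u)"
        using expand[of q "xpow m * u"] q(2) by (simp add: shift)
      also have "\<dots> = Poly_Mapping.lookup q l * T (l + m) u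
          + (\<Sum>k\<in>?K. Poly_Mapping.lookup q k * T (k + m) u)"
        using l by (simp add: sum.remove)
      finally have "T (l + m) u = - (\<Sum>k\<in>?K. Poly_Mapping.lookup q k * T (k + m) u) / Poly_Mapping.lookup q l"
        using l by (simp add: in_keys_iff field_simps eq_neg_iff_add_eq_0)
      then show ?thesis by (simp add: sum_negf sum_divide_distrib)
    qed
    then have "T (l + m) = (\<Sum>k\<in>?K. fun_scale (?c k) (T (k + m)))"
      by (intro ext) (simp only: sum_apply finite_Diff finite_keys)
    then show ?thesis using rest by (simp only:) (intro fs.span_sum fs.span_scale, blast)
  qed
  have "a - int N \<le> n \<Longrightarrow> n \<le> b + int N \<Longrightarrow> T n \<in> fs.span S" for N n
  proof (induction N arbitrary: n)
    case 0
    then show ?case by (intro fs.span_base) (auto simp: S_def)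
  next
    case (Suc N)
    consider "a - int N \<le> n" "n \<le> b + int N" | "n = b + (int N + 1)" | "n = a + (- int N - 1)"
      using Suc.prems by linarith
    then show ?case
    proof cases
      case 1
      then show ?thesis by (rule Suc.IH)
    next
      case 2
      show ?thesis unfolding 2
      proof (rule solve[OF ab(2)])
        fix k assume "k \<in> Poly_Mapping.keys q" "k \<noteq> b"
        then have "a \<le> k" "k < b" using bounds[of k] by auto
        then show "T (k + (int N + 1)) \<in> fs.span S" by (intro Suc.IH) auto
      qed
    next
      case 3
      show ?thesis unfolding 3
      proof (rule solve[OF ab(1)])
        fix k assume "k \<in> Poly_Mapping.keys q" "k \<noteq> a"
        then have "a < k" "k \<le> b" using bounds[of k] by auto
        then show "T (k + (- int N - 1)) \<in> fs.span S" by (intro Suc.IH) auto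
      qed
    qed
  qed
  from this[of "nat \<bar>n - a\<bar> + nat \<bar>n - b\<bar>" n for n] have T: "T n \<in> fs.span S" for n
    by simp
  show ?thesis
  proof (rule that)
    show "finite S" by (simp add: S_def)
    show "S \<subseteq> laurent_circ" using laurent_circ_mult[OF assms] by (auto simp: S_def T_def)
    fix p
    have "(\<lambda>u. f (p * u)) = (\<Sum>k\<in>Poly_Mapping.keys p. fun_scale (Poly_Mapping.lookup p k) (T k))"
      by (intro ext) (simp add: expand sum_apply)
    then show "(\<lambda>u. f (p * u)) \<in> fs.span S"
      by (simp only:) (intro fs.span_sum fs.span_scale T)
  qed
qed

text \<open>The coalgebra structure dual to the multiplication.\<close>

lemma laurent_circ_comult:
  fixes f :: "'k::field laurent \<Rightarrow> 'k"
  assumes "f \<in> laurent_circ"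
  obtains P :: "'k laurent set" and g h where "finite P"
    "\<And>p. p \<in> P \<Longrightarrow> g p \<in> laurent_circ" "\<And>p. p \<in> P \<Longrightarrow> h p \<in> laurent_circ"
    "\<And>u w. f (u * w) = (\<Sum>p\<in>P. g p u * h p w)"
proof -
  obtain S where S: "finite S" "S \<subseteq> laurent_circ" "\<And>p. (\<lambda>u. f (p * u)) \<in> fs.span S"
    by (fact laurent_circ_finite_orbit[OF assms])
  obtain P e where P: "finite P" and e: "\<And>p. p \<in> P \<Longrightarrow> e p \<in> fs.span S"
    and "\<And>p q. p \<in> P \<Longrightarrow> q \<in> P \<Longrightarrow> e p q = (if p = q then 1 else 0)"
    and rep: "\<And>w x. w \<in> fs.span S \<Longrightarrow> w x = (\<Sum>p\<in>P. w p * e p x)"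
    by (fact interpolation_points[OF S(1)])
  have "fs.span S \<subseteq> laurent_circ" using S(2) by (simp add: fs.span_minimal subspace_laurent_circ)
  then have "e p \<in> laurent_circ" if "p \<in> P" for p using e[OF that] by blast
  moreover have "f (u * w) = (\<Sum>p\<in>P. f (p * u) * e p w)" for u w
    using rep[OF S(3)[of u], of w] by (simp add: mult.commute[of u])
  ultimately show ?thesis
    using P laurent_circ_mult[OF assms] by (intro that[of P "\<lambda>p u. f (p * u)" e])
qed

section \<open>The maximal good subspace\<close>

lemma homogeneous_system_nontrivial:
  fixes m :: "'i \<Rightarrow> 'a \<Rightarrow> 'k::field"
  assumes "finite I" "finite A" "card I < card A"
  shows "\<exists>c. (\<exists>a\<in>A. c a \<noteq> 0) \<and> (\<forall>i\<in>I. (\<Sum>a\<in>A. c a * m i a) = 0)"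
  using assms
proof (induction I arbitrary: A m rule: finite_induct)
  case empty
  then have "A \<noteq> {}" by auto
  then show ?case by (intro exI[of _ "\<lambda>_. 1"]) auto
next
  case (insert i I)
  show ?case
  proof (cases "\<forall>a\<in>A. m i a = 0")
    case True
    have "card I < card A" using insert by simp
    then show ?thesis using insert.IH[of A m] insert.prems True by auto
  next
    case False
    then obtain p where p: "p \<in> A" "m i p \<noteq> 0" by blast
    \<comment> \<open>Eliminate the unknown \<open>p\<close> by means of equation \<open>i\<close>.\<close>
    define m' where "m' = (\<lambda>j a. m j a - m j p * m i a / m i p)"
    have "card I < card (A - {p})" using insert p by simp
    then obtain c where c: "\<exists>a\<in>A - {p}. c a \<noteq> 0" "\<forall>j\<in>I. (\<Sum>a\<in>A - {p}. c a * m' j a) = 0"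
      using insert.IH[of "A - {p}" m'] insert.prems by auto
    define S where "S = (\<Sum>a\<in>A - {p}. c a * m i a)"
    define c' where "c' = (\<lambda>a. if a = p then - S / m i p else c a)"
    have c': "(\<Sum>a\<in>A. c' a * m j a) = - S / m i p * m j p + (\<Sum>a\<in>A - {p}. c a * m j a)" for j
    proof -
      have "(\<Sum>a\<in>A. c' a * m j a) = c' p * m j p + (\<Sum>a\<in>A - {p}. c' a * m j a)"
        by (rule sum.remove[OF insert.prems(1) p(1)])
      also have "(\<Sum>a\<in>A - {p}. c' a * m j a) = (\<Sum>a\<in>A - {p}. c a * m j a)"
        by (rule sum.cong) (auto simp: c'_def)
      finally show ?thesis by (simp add: c'_def)
    qed
    have "(\<Sum>a\<in>A. c' a * m j a) = 0" if "j \<in> I" for j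
    proof -
      have "(\<Sum>a\<in>A - {p}. c a * m' j a) = (\<Sum>a\<in>A - {p}. c a * m j a) - (\<Sum>a\<in>A - {p}. c a * m i a) * (m j p / m i p)"
        unfolding m'_def sum_distrib_right sum_subtractf[symmetric]
        by (rule sum.cong) (auto simp: algebra_simps)
      then show ?thesis unfolding c' using c(2) that by (simp add: S_def)
    qed
    moreover have "(\<Sum>a\<in>A. c' a * m i a) = 0" unfolding c' using p by (simp add: S_def)
    moreover have "\<exists>a\<in>A. c' a \<noteq> 0" using c(1) by (auto simp: c'_def)
    ultimately show ?thesis by blast
  qed
qed

lemma laurent_common_kernel:
  assumes I: "finite I" and A: "finite A" "card I < card A"
    and g: "\<And>i. i \<in> I \<Longrightarrow> g i \<in> dual_space laurent_scale"
  obtains u where "u \<noteq> 0" "Poly_Mapping.keys u \<subseteq> A" "\<And>i. i \<in> I \<Longrightarrow> g i u = 0"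
proof -
  obtain c where c: "\<exists>a\<in>A. c a \<noteq> 0" "\<And>i. i \<in> I \<Longrightarrow> (\<Sum>a\<in>A. c a * g i (xpow a)) = 0"
    using homogeneous_system_nontrivial[OF I A, of "\<lambda>i a. g i (xpow a)"] by blast
  define u where "u = (\<Sum>a\<in>A. Poly_Mapping.single a (c a))"
  have lookup_u: "Poly_Mapping.lookup u a = (if a \<in> A then c a else 0)" for a
    using A(1) by (simp add: u_def lookup_sum lookup_single when_def)
  show ?thesis
  proof (rule that[of u])
    show "u \<noteq> 0" using c(1) lookup_u by (metis lookup_zero)
    show keys: "Poly_Mapping.keys u \<subseteq> A" using lookup_u by (auto simp: in_keys_iff split: if_splits)
    show "g i u = 0" if "i \<in> I" for i
      using laurent_dual_expand[OF g[OF that] A(1) keys] c(2)[OF that] by (simp add: lookup_u)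
  qed
qed

lemma wronskian_nonzero:
  fixes u s :: "'k::field_char_0 laurent"
  assumes "u \<noteq> 0" "s \<noteq> 0" "Max (Poly_Mapping.keys u) \<noteq> Max (Poly_Mapping.keys s)"
  shows "u * laurent_deriv s - s * laurent_deriv u \<noteq> 0"
proof -
  define d e where "d = Max (Poly_Mapping.keys u)" and "e = Max (Poly_Mapping.keys s)"
  have lead: "Poly_Mapping.lookup u d \<noteq> 0" "Poly_Mapping.lookup s e \<noteq> 0"
    using Max_in[OF finite_keys, of u] Max_in[OF finite_keys, of s] assms(1,2)
    by (auto simp: d_def e_def in_keys_iff)
  have above: "Poly_Mapping.lookup u k = 0" if "k > d" for k
    using that Max_ge[OF finite_keys, of k u] unfolding d_def by (metis in_keys_iff not_le)
  have above': "Poly_Mapping.lookup s k = 0" if "k > e" for k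
    using that Max_ge[OF finite_keys, of k s] unfolding e_def by (metis in_keys_iff not_le)
  \<comment> \<open>The top coefficient of the Wronskian is \<open>e - d\<close> times the product of the leading coefficients.\<close>
  have "Poly_Mapping.lookup (u * laurent_deriv s) (d + (e - 1)) =
      Poly_Mapping.lookup u d * (of_int e * Poly_Mapping.lookup s e)"
    by (subst lookup_mult_top) (auto simp: lookup_laurent_deriv above above')
  moreover have "Poly_Mapping.lookup (s * laurent_deriv u) (e + (d - 1)) =
      Poly_Mapping.lookup s e * (of_int d * Poly_Mapping.lookup u d)"
    by (subst lookup_mult_top) (auto simp: lookup_laurent_deriv above above')
  moreover have "e + (d - 1) = d + (e - 1)" by simp
  ultimately have "Poly_Mapping.lookup (u * laurent_deriv s - s * laurent_deriv u) (d + (e - 1)) =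
      (of_int e - of_int d) * (Poly_Mapping.lookup u d * Poly_Mapping.lookup s e)"
    by (simp add: lookup_minus algebra_simps)
  moreover have "(of_int e - of_int d :: 'k) \<noteq> 0" using assms(3) by (simp add: d_def e_def)
  ultimately have "Poly_Mapping.lookup (u * laurent_deriv s - s * laurent_deriv u) (d + (e - 1)) \<noteq> 0"
    using lead by simp
  then show ?thesis by (metis lookup_zero)
qed

text \<open>If \<open>(u, w) \<mapsto> f (u w' - w u')\<close> has finite rank, its left kernel contains nonzero \<open>u\<close> and \<open>s\<close> with
  disjoint supports. Evaluating at \<open>(u, s w)\<close> and \<open>(s, u w)\<close> and subtracting shows that the
  Wronskian \<open>u s' - s u'\<close> annihilates \<open>f\<close>.\<close>

lemma witt_finite_rank_laurent_circ:
  fixes f :: "'k::field_char_0 laurent \<Rightarrow> 'k"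
  assumes f: "f \<in> dual_space laurent_scale" and I: "finite I"
    and g: "\<And>i. i \<in> I \<Longrightarrow> g i \<in> dual_space laurent_scale"
    and rank: "\<And>u w. f (u * laurent_deriv w - w * laurent_deriv u) = (\<Sum>i\<in>I. g i u * h i w)"
  shows "f \<in> laurent_circ"
proof -
  define n where "n = int (card I)"
  obtain u where u: "u \<noteq> 0" "Poly_Mapping.keys u \<subseteq> {0..n}" "\<And>i. i \<in> I \<Longrightarrow> g i u = 0"
    by (rule laurent_common_kernel[OF I _ _ g, of "{0..n}"]) (auto simp: n_def)
  obtain s where s: "s \<noteq> 0" "Poly_Mapping.keys s \<subseteq> {n+1..2*n+1}" "\<And>i. i \<in> I \<Longrightarrow> g i s = 0"
    by (rule laurent_common_kernel[OF I _ _ g, of "{n+1..2*n+1}"]) (auto simp: n_def)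
  define q where "q = u * laurent_deriv s - s * laurent_deriv u"
  have "Poly_Mapping.keys u \<noteq> {}" "Poly_Mapping.keys s \<noteq> {}" using u(1) s(1) by simp_all
  then have "Max (Poly_Mapping.keys u) \<in> {0..n}" "Max (Poly_Mapping.keys s) \<in> {n+1..2*n+1}"
    using Max_in[OF finite_keys, of u] Max_in[OF finite_keys, of s] u(2) s(2) by blast+
  then have "q \<noteq> 0" unfolding q_def by (intro wronskian_nonzero u(1) s(1)) auto
  moreover have "f (q * w) = 0" for w
  proof -
    have "f (u * laurent_deriv (s * w) - s * w * laurent_deriv u) = 0"
      "f (s * laurent_deriv (u * w) - u * w * laurent_deriv s) = 0"
      unfolding rank by (simp_all add: u(3) s(3))
    moreover have "q * w + q * w = (u * laurent_deriv (s * w) - s * w * laurent_deriv u)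
        - (s * laurent_deriv (u * w) - u * w * laurent_deriv s)"
      by (simp add: q_def laurent_deriv_mult algebra_simps)
    ultimately have "f (q * w + q * w) = 0" by (simp add: dual_spaceD(4)[OF f])
    then have "f (q * w) + f (q * w) = 0" by (simp only: dual_spaceD(1)[OF f])
    then show ?thesis by simp
  qed
  ultimately show ?thesis unfolding laurent_circ_iff using f by blast
qed

lemma deriv_finite_rank_laurent_circ:
  fixes f :: "'k::field_char_0 laurent \<Rightarrow> 'k"
  assumes f: "f \<in> dual_space laurent_scale" and I: "finite I"
    and h: "\<And>i. i \<in> I \<Longrightarrow> h i \<in> dual_space laurent_scale"
    and rank: "\<And>u w. f (u * laurent_deriv w) = (\<Sum>i\<in>I. g i u * h i w)"
  shows "f \<in> laurent_circ"
proof -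
  \<comment> \<open>Constants are excluded from the support, so that the derivative does not vanish.\<close>
  obtain w where w: "w \<noteq> 0" "Poly_Mapping.keys w \<subseteq> {1..int (card I) + 1}" "\<And>i. i \<in> I \<Longrightarrow> h i w = 0"
    by (rule laurent_common_kernel[OF I _ _ h, of "{1..int (card I) + 1}"]) auto
  obtain k where k: "k \<in> Poly_Mapping.keys w" using w(1) by (metis all_not_in_conv keys_eq_empty)
  then have "Poly_Mapping.lookup (laurent_deriv w) (k - 1) \<noteq> 0"
    using w(2) by (auto simp: lookup_laurent_deriv in_keys_iff)
  then have "laurent_deriv w \<noteq> 0" by (metis lookup_zero)
  moreover have "f (laurent_deriv w * u) = 0" for u
    using rank[of u w] by (simp add: w(3) mult.commute)
  ultimately show ?thesis unfolding laurent_circ_iff using f by blast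
qed

lemma hv_dual_components:
  fixes F :: "'a::field hv \<Rightarrow> 'a"
  assumes "F \<in> dual_space hv_scale"
  shows "(\<lambda>u. F (u, 0)) \<in> dual_space laurent_scale" "(\<lambda>u. F (0, u)) \<in> dual_space laurent_scale"
    "F v = F (fst v, 0) + F (0, snd v)"
proof -
  have "laurent_scale c 0 = 0" for c :: 'a by (simp add: laurent_scale_conv_mult)
  then have "(u + v, 0 :: 'a laurent) = (u, 0) + (v, 0)" "(0 :: 'a laurent, u + v) = (0, u) + (0, v)"
    "(laurent_scale c u, 0) = hv_scale c (u, 0)" "(0, laurent_scale c u) = hv_scale c (0, u)"
    for u v :: "'a laurent" and c
    by (simp_all add: hv_scale_def)
  then show "(\<lambda>u. F (u, 0)) \<in> dual_space laurent_scale" "(\<lambda>u. F (0, u)) \<in> dual_space laurent_scale"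
    by (auto intro!: dual_spaceI vector_space_laurent simp: dual_spaceD[OF assms] simp del: add_Pair)
  show "F v = F (fst v, 0) + F (0, snd v)"
    by (simp add: dual_spaceD(1)[OF assms, symmetric])
qed

lemma laurent_circ_sum_iff:
  "F \<in> laurent_circ_sum \<longleftrightarrow> F \<in> dual_space hv_scale \<and>
    (\<lambda>u. F (u, 0)) \<in> laurent_circ \<and> (\<lambda>u. F (0, u)) \<in> laurent_circ"
proof
  assume "F \<in> laurent_circ_sum"
  then obtain f g where F: "F = (\<lambda>v. f (fst v) + g (snd v))" and fg: "f \<in> laurent_circ" "g \<in> laurent_circ"
    by (auto simp: laurent_circ_sum_def)
  note lin = fg[THEN laurent_circ_dual, THEN dual_spaceD(1)] fg[THEN laurent_circ_dual, THEN dual_spaceD(2)]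
    fg[THEN laurent_circ_dual, THEN dual_spaceD(5)]
  have "F \<in> dual_space hv_scale"
    by (rule dual_spaceI[OF vector_space_hv]) (simp_all add: F hv_scale_def lin algebra_simps)
  then show "F \<in> dual_space hv_scale \<and> (\<lambda>u. F (u, 0)) \<in> laurent_circ \<and> (\<lambda>u. F (0, u)) \<in> laurent_circ"
    using fg by (simp add: F lin)
next
  assume F: "F \<in> dual_space hv_scale \<and> (\<lambda>u. F (u, 0)) \<in> laurent_circ \<and> (\<lambda>u. F (0, u)) \<in> laurent_circ"
  then have "F = (\<lambda>v. F (fst v, 0) + F (0, snd v))"
    by (intro ext hv_dual_components(3)) blast
  then show "F \<in> laurent_circ_sum"
    unfolding laurent_circ_sum_def
    by (intro CollectI exI[of _ "\<lambda>u. F (u, 0)"] exI[of _ "\<lambda>u. F (0, u)"] conjI)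
       (use F in simp_all)
qed

lemma subspace_laurent_circ_sum: "fs.subspace laurent_circ_sum"
proof (rule fs.subspaceI)
  note lc = subspace_laurent_circ
  have "(0 :: 'a hv \<Rightarrow> 'a) \<in> dual_space hv_scale" by (rule dual_spaceI[OF vector_space_hv]) auto
  moreover have "(\<lambda>u. 0) \<in> (laurent_circ :: ('a laurent \<Rightarrow> 'a) set)"
    using fs.subspace_0[OF lc] by (simp add: zero_fun_def)
  ultimately show "(0 :: 'a hv \<Rightarrow> 'a) \<in> laurent_circ_sum"
    unfolding laurent_circ_sum_iff by simp
next
  fix F G :: "'a hv \<Rightarrow> 'a" and c assume F: "F \<in> laurent_circ_sum" and G: "G \<in> laurent_circ_sum"
  have "F + G \<in> dual_space hv_scale" "fun_scale c F \<in> dual_space hv_scale"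
    using F[unfolded laurent_circ_sum_iff] G[unfolded laurent_circ_sum_iff]
    by (auto intro!: dual_spaceI[OF vector_space_hv] simp: dual_spaceD(1,2) algebra_simps fun_scale_def
        simp del: add_Pair)
  moreover have "(\<lambda>u. (F + G) (u, 0)) = (\<lambda>u. F (u, 0)) + (\<lambda>u. G (u, 0))"
    "(\<lambda>u. (F + G) (0, u)) = (\<lambda>u. F (0, u)) + (\<lambda>u. G (0, u))"
    "(\<lambda>u. fun_scale c F (u, 0)) = fun_scale c (\<lambda>u. F (u, 0))"
    "(\<lambda>u. fun_scale c F (0, u)) = fun_scale c (\<lambda>u. F (0, u))"
    by (simp_all add: fun_eq_iff fun_scale_def)
  ultimately show "F + G \<in> laurent_circ_sum" "fun_scale c F \<in> laurent_circ_sum"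
    using F G unfolding laurent_circ_sum_iff
    by (simp_all only: fs.subspace_add[OF subspace_laurent_circ] fs.subspace_scale[OF subspace_laurent_circ])
qed

lemma laurent_circ_sum_embed:
  assumes "f \<in> laurent_circ"
  shows "(\<lambda>v. f (fst v)) \<in> laurent_circ_sum" "(\<lambda>v. f (snd v)) \<in> laurent_circ_sum"
proof -
  have "(\<lambda>_. 0) \<in> (laurent_circ :: ('a laurent \<Rightarrow> 'a) set)"
    using fs.subspace_0[OF subspace_laurent_circ] by (simp add: zero_fun_def)
  then show "(\<lambda>v. f (fst v)) \<in> laurent_circ_sum" "(\<lambda>v. f (snd v)) \<in> laurent_circ_sum"
    using assms unfolding laurent_circ_sum_def by force+
qed

lemma good_laurent_circ_sum:
  "good_subspace hv_scale hv_bracket (laurent_circ_sum :: ('k::field hv \<Rightarrow> 'k) set)"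
  unfolding good_subspace_def
proof (intro conjI subsetI)
  show "module.subspace fun_scale (laurent_circ_sum :: ('k hv \<Rightarrow> 'k) set)"
    by (rule subspace_laurent_circ_sum)
  show "F \<in> dual_space hv_scale" if "F \<in> laurent_circ_sum" for F :: "'k hv \<Rightarrow> 'k"
    using that by (simp add: laurent_circ_sum_iff)
  let ?U = "laurent_circ_sum :: ('k hv \<Rightarrow> 'k) set"
  let ?W = "fs2.span {form_tens f h | f h. f \<in> ?U \<and> h \<in> ?U}"
  have mult: "(\<lambda>\<xi> \<eta>. f (pr \<xi> * pr' \<eta>)) \<in> ?W"
    if f: "f \<in> laurent_circ"
      and pr: "\<And>g. g \<in> laurent_circ \<Longrightarrow> (\<lambda>v. g (pr v)) \<in> ?U"
      and pr': "\<And>g. g \<in> laurent_circ \<Longrightarrow> (\<lambda>v. g (pr' v)) \<in> ?U"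
    for f :: "'k laurent \<Rightarrow> 'k" and pr pr' :: "'k hv \<Rightarrow> 'k laurent"
  proof -
    obtain P :: "'k laurent set" and g h where P: "finite P"
      and gh: "\<And>p. p \<in> P \<Longrightarrow> g p \<in> laurent_circ" "\<And>p. p \<in> P \<Longrightarrow> h p \<in> laurent_circ"
      and comult: "\<And>u w. f (u * w) = (\<Sum>p\<in>P. g p u * h p w)"
      by (fact laurent_circ_comult[OF f])
    have "(\<Sum>p\<in>A. form_tens (\<lambda>v. g p (pr v)) (\<lambda>v. h p (pr' v))) \<xi> \<eta>
        = (\<Sum>p\<in>A. g p (pr \<xi>) * h p (pr' \<eta>))" if "finite A" for A \<xi> \<eta>
      using that by induction (auto simp: form_tens_def)
    then have "(\<lambda>\<xi> \<eta>. f (pr \<xi> * pr' \<eta>)) = (\<Sum>p\<in>P. form_tens (\<lambda>v. g p (pr v)) (\<lambda>v. h p (pr' v)))"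
      using P by (intro ext) (simp add: comult)
    also have "\<dots> \<in> ?W"
    proof (rule fs2.span_sum, rule fs2.span_base)
      fix p assume "p \<in> P"
      then show "form_tens (\<lambda>v. g p (pr v)) (\<lambda>v. h p (pr' v)) \<in> {form_tens f h | f h. f \<in> ?U \<and> h \<in> ?U}"
        using gh pr pr' by blast
    qed
    finally show ?thesis .
  qed
  fix C assume "C \<in> dual_cobracket hv_bracket ` ?U"
  then obtain F where F: "F \<in> ?U" and C: "C = dual_cobracket hv_bracket F" by blast
  define f g where "f = (\<lambda>u. F (u, 0))" and "g = (\<lambda>u. F (0, u))"
  have fg: "f \<in> laurent_circ" "g \<in> laurent_circ" and dual: "F \<in> dual_space hv_scale"
    using F by (simp_all add: laurent_circ_sum_iff f_def g_def)
  note lin = fg[THEN laurent_circ_dual, THEN dual_spaceD(4)]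
  have expand: "C = (\<lambda>\<xi> \<eta>. f (fst \<xi> * laurent_deriv (fst \<eta>))) - (\<lambda>\<xi> \<eta>. f (laurent_deriv (fst \<xi>) * fst \<eta>))
      + (\<lambda>\<xi> \<eta>. g (fst \<xi> * laurent_deriv (snd \<eta>))) - (\<lambda>\<xi> \<eta>. g (laurent_deriv (snd \<xi>) * fst \<eta>))"
  proof (intro ext)
    fix \<xi> \<eta>
    have "C \<xi> \<eta> = f (fst (hv_bracket \<xi> \<eta>)) + g (snd (hv_bracket \<xi> \<eta>))"
      unfolding C dual_cobracket_def f_def g_def by (rule hv_dual_components(3)[OF dual])
    then show "C \<xi> \<eta> = ((\<lambda>\<xi> \<eta>. f (fst \<xi> * laurent_deriv (fst \<eta>))) - (\<lambda>\<xi> \<eta>. f (laurent_deriv (fst \<xi>) * fst \<eta>))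
      + (\<lambda>\<xi> \<eta>. g (fst \<xi> * laurent_deriv (snd \<eta>))) - (\<lambda>\<xi> \<eta>. g (laurent_deriv (snd \<xi>) * fst \<eta>))) \<xi> \<eta>"
      by (simp add: hv_bracket_def lin mult.commute)
  qed
  show "C \<in> ?W" unfolding expand
    by (intro fs2.span_diff fs2.span_add mult fg laurent_circ_sum_embed
        laurent_circ_sum_embed[OF laurent_circ_deriv])
qed

lemma good_subspace_le_laurent_circ_sum:
  fixes U :: "('k::field_char_0 hv \<Rightarrow> 'k) set"
  assumes "good_subspace hv_scale hv_bracket U"
  shows "U \<subseteq> laurent_circ_sum"
proof
  fix F assume F: "F \<in> U"
  have U: "fs.subspace U" and U_dual: "U \<subseteq> dual_space hv_scale"
    using assms by (simp_all add: good_subspace_def)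
  have "dual_cobracket hv_bracket F \<in> fs2.span {form_tens f h | f h. f \<in> U \<and> h \<in> U}"
    using assms F unfolding good_subspace_def by blast
  from form_tens_span[OF this U] obtain ps where ps: "set ps \<subseteq> U \<times> U"
    "\<And>\<xi> \<eta>. F (hv_bracket \<xi> \<eta>) = (\<Sum>(g, h)\<leftarrow>ps. g \<xi> * h \<eta>)"
    unfolding dual_cobracket_def by blast
  define I where "I = {0..<length ps}"
  define g h where "g = (\<lambda>i. fst (ps ! i))" and "h = (\<lambda>i. snd (ps ! i))"
  have gh: "g i \<in> dual_space hv_scale" "h i \<in> dual_space hv_scale" if "i \<in> I" for i
  proof -
    have "ps ! i \<in> U \<times> U" using ps(1) that nth_mem[of i ps] by (auto simp: I_def)
    then show "g i \<in> dual_space hv_scale" "h i \<in> dual_space hv_scale"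
      using U_dual by (auto simp: g_def h_def mem_Times_iff)
  qed
  have rank: "F (hv_bracket \<xi> \<eta>) = (\<Sum>i\<in>I. g i \<xi> * h i \<eta>)" for \<xi> \<eta>
    unfolding ps(2) by (simp add: sum_list_sum_nth I_def g_def h_def case_prod_unfold)
  have F_dual: "F \<in> dual_space hv_scale" using F U_dual by blast
  have "(\<lambda>u. F (u, 0)) \<in> laurent_circ"
  proof (rule witt_finite_rank_laurent_circ)
    show "F (u * laurent_deriv w - w * laurent_deriv u, 0) = (\<Sum>i\<in>I. g i (u, 0) * h i (w, 0))" for u w
      unfolding rank[symmetric] by (simp add: hv_bracket_def)
  qed (use F_dual gh in \<open>simp_all add: I_def hv_dual_components(1)\<close>)
  moreover have "(\<lambda>u. F (0, u)) \<in> laurent_circ"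
  proof (rule deriv_finite_rank_laurent_circ)
    show "F (0, u * laurent_deriv w) = (\<Sum>i\<in>I. g i (u, 0) * h i (0, w))" for u w
      unfolding rank[symmetric] by (simp add: hv_bracket_def)
  qed (use F_dual gh in \<open>simp_all add: I_def hv_dual_components(2)\<close>)
  ultimately show "F \<in> laurent_circ_sum" using F_dual by (simp add: laurent_circ_sum_iff)
qed

lemma maximal_good_hv:
  "maximal_good (hv_scale :: 'k::field_char_0 \<Rightarrow> 'k hv \<Rightarrow> 'k hv) hv_bracket = laurent_circ_sum"
proof
  show "maximal_good (hv_scale :: 'k \<Rightarrow> 'k hv \<Rightarrow> 'k hv) hv_bracket \<subseteq> laurent_circ_sum"
    unfolding maximal_good_def
    by (rule fs.span_minimal[OF _ subspace_laurent_circ_sum]) (use good_subspace_le_laurent_circ_sum in blast)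
  show "(laurent_circ_sum :: ('k hv \<Rightarrow> 'k) set) \<subseteq> maximal_good hv_scale hv_bracket"
    unfolding maximal_good_def using good_laurent_circ_sum by (intro subsetI fs.span_base) blast
qed

section \<open>Formal sums of dual basis vectors\<close>

lemma termwise_sumI:
  assumes "\<And>x. finite (A x)" "\<And>x. A x \<subseteq> S" "\<And>x i. i \<in> S \<Longrightarrow> i \<notin> A x \<Longrightarrow> t i x = 0"
    "\<And>x. F x = (\<Sum>i\<in>A x. t i x)"
  shows "termwise_sum S t F"
  unfolding termwise_sum_def
proof (intro allI conjI)
  fix x
  have sub: "{i \<in> S. t i x \<noteq> 0} \<subseteq> A x" using assms(3) by blast
  then show "finite {i \<in> S. t i x \<noteq> 0}" using assms(1) finite_subset by blast
  show "F x = (\<Sum>i | i \<in> S \<and> t i x \<noteq> 0. t i x)"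
    unfolding assms(4) using assms(1,2) sub by (intro sum.mono_neutral_right) auto
qed

lemma termwise_sum_unique: "termwise_sum S t F \<Longrightarrow> termwise_sum S t G \<Longrightarrow> F = G"
  by (auto simp: termwise_sum_def fun_eq_iff)

lemma termwise_sum2_unique: "termwise_sum2 S t F \<Longrightarrow> termwise_sum2 S t G \<Longrightarrow> F = G"
  unfolding termwise_sum2_def by (rule ext) (blast intro: termwise_sum_unique)

lemma eps_dual: "eps a \<in> dual_space hv_scale"
  by (cases a) (auto intro!: dual_spaceI[OF vector_space_hv]
      simp: hv_scale_def lookup_add lookup_laurent_scale)

lemma finite_eps_support: "finite {a. eps a v \<noteq> 0}"
proof -
  have "{a. eps a v \<noteq> 0} \<subseteq> Poly_Mapping.keys (fst v) <+> Poly_Mapping.keys (snd v)"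
  proof
    fix a assume "a \<in> {a. eps a v \<noteq> 0}"
    then show "a \<in> Poly_Mapping.keys (fst v) <+> Poly_Mapping.keys (snd v)"
      by (cases a) (auto simp: in_keys_iff)
  qed
  then show ?thesis by (rule finite_subset) simp
qed

lemma hv_dual_expand:
  fixes f :: "'k::field hv \<Rightarrow> 'k"
  assumes f: "f \<in> dual_space hv_scale" and A: "finite A" "{a. eps a v \<noteq> 0} \<subseteq> A"
  shows "f v = (\<Sum>a\<in>A. f (hv_basis a) * eps a v)"
proof -
  let ?K = "Poly_Mapping.keys (fst v)" and ?K' = "Poly_Mapping.keys (snd v)"
  have supp: "a \<in> ?K <+> ?K' \<longleftrightarrow> eps a v \<noteq> 0" for a by (cases a) (auto simp: in_keys_iff)
  have "f v = f (fst v, 0) + f (0, snd v)" by (rule hv_dual_components(3)[OF f])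
  also have "\<dots> = (\<Sum>k\<in>?K. Poly_Mapping.lookup (fst v) k * f (xpow k, 0))
      + (\<Sum>k\<in>?K'. Poly_Mapping.lookup (snd v) k * f (0, xpow k))"
    using laurent_dual_expand[OF hv_dual_components(1)[OF f] finite_keys order_refl, of "fst v"]
      laurent_dual_expand[OF hv_dual_components(2)[OF f] finite_keys order_refl, of "snd v"] by simp
  also have "\<dots> = (\<Sum>a\<in>?K <+> ?K'. f (hv_basis a) * eps a v)"
    by (simp add: sum.Plus mult.commute)
  also have "\<dots> = (\<Sum>a\<in>A. f (hv_basis a) * eps a v)"
  proof (rule sum.mono_neutral_left[OF A(1)])
    show "?K <+> ?K' \<subseteq> A" using A(2) supp by blast
    show "\<forall>a\<in>A - (?K <+> ?K'). f (hv_basis a) * eps a v = 0" using supp by auto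
  qed
  finally show ?thesis .
qed

lemma formally_linear_unique:
  assumes "formally_linear C" "formally_linear C'" "\<And>a. C (eps a) = C' (eps a)" "f \<in> dual_space hv_scale"
  shows "C f = C' f"
proof (rule termwise_sum2_unique)
  show "termwise_sum2 UNIV (\<lambda>a \<xi> \<eta>. f (hv_basis a) * C' (eps a) \<xi> \<eta>) (C' f)"
    using assms(2,4) unfolding formally_linear_def by blast
  show "termwise_sum2 UNIV (\<lambda>a \<xi> \<eta>. f (hv_basis a) * C' (eps a) \<xi> \<eta>) (C f)"
    using assms(1,4) unfolding formally_linear_def assms(3) by blast
qed

lemma formally_bilinear_unique:
  assumes "formally_bilinear B" "formally_bilinear B'" "\<And>a b. B (eps a) (eps b) = B' (eps a) (eps b)"
    "f \<in> dual_space hv_scale" "h \<in> dual_space hv_scale"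
  shows "B f h = B' f h"
  using assms unfolding formally_bilinear_def
  by (intro termwise_sum_unique[of UNIV "\<lambda>(a, b) \<xi>. f (hv_basis a) * h (hv_basis b) * B' (eps a) (eps b) \<xi>"]) auto

lemma formally_linear_dual_cobracket: "formally_linear (dual_cobracket hv_bracket)"
  unfolding formally_linear_def termwise_sum2_def
proof (intro ballI allI)
  fix f :: "'a hv \<Rightarrow> 'a" and \<xi> assume f: "f \<in> dual_space hv_scale"
  show "termwise_sum UNIV (\<lambda>a \<eta>. f (hv_basis a) * dual_cobracket hv_bracket (eps a) \<xi> \<eta>)
      (dual_cobracket hv_bracket f \<xi>)"
  proof (rule termwise_sumI[where A = "\<lambda>\<eta>. {a. eps a (hv_bracket \<xi> \<eta>) \<noteq> 0}"])
    fix \<eta>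
    show "dual_cobracket hv_bracket f \<xi> \<eta> = (\<Sum>a | eps a (hv_bracket \<xi> \<eta>) \<noteq> 0.
        f (hv_basis a) * dual_cobracket hv_bracket (eps a) \<xi> \<eta>)"
      unfolding dual_cobracket_def by (rule hv_dual_expand[OF f finite_eps_support order_refl])
  qed (simp_all add: finite_eps_support dual_cobracket_def)
qed

section \<open>The structure maps on dual basis vectors\<close>

lemma lookup_deriv_mult_finite:
  fixes u w :: "'k::field laurent"
  assumes "finite K" "Poly_Mapping.keys u \<subseteq> K"
  shows "Poly_Mapping.lookup (w * laurent_deriv u) p =
    (\<Sum>k\<in>K. of_int k * Poly_Mapping.lookup u k * Poly_Mapping.lookup w (p + 1 - k))"
proof -
  have "Poly_Mapping.keys (laurent_deriv u) \<subseteq> (\<lambda>k. k - 1) ` K"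
  proof
    fix l assume "l \<in> Poly_Mapping.keys (laurent_deriv u)"
    then have "l + 1 \<in> K" using assms(2) by (auto simp: in_keys_iff lookup_laurent_deriv)
    then show "l \<in> (\<lambda>k. k - 1) ` K" by (intro image_eqI[of _ _ "l + 1"]) auto
  qed
  then have "Poly_Mapping.lookup (laurent_deriv u * w) p = (\<Sum>l\<in>(\<lambda>k. k - 1) ` K.
      Poly_Mapping.lookup (laurent_deriv u) l * Poly_Mapping.lookup w (p - l))"
    using assms(1) by (intro lookup_mult_finite) auto
  also have "\<dots> = (\<Sum>k\<in>K. of_int k * Poly_Mapping.lookup u k * Poly_Mapping.lookup w (p + 1 - k))"
    by (subst sum.reindex) (auto simp: inj_on_def lookup_laurent_deriv algebra_simps)
  finally show ?thesis by (simp add: mult.commute)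
qed

lemma dual_cobracket_eps1:
  "termwise_sum2 {(i, j). i + j = p + 1}
    (\<lambda>(i, j) \<xi> \<eta>. of_int (j - i) * form_tens (eps1 i) (eps1 j) \<xi> \<eta>)
    (dual_cobracket hv_bracket (eps1 p))"
  unfolding termwise_sum2_def
proof
  fix \<xi> :: "'a hv"
  let ?K = "Poly_Mapping.keys (fst \<xi>)"
  show "termwise_sum {(i, j). i + j = p + 1}
      (\<lambda>ij. (case ij of (i, j) \<Rightarrow> \<lambda>\<xi> \<eta>. of_int (j - i) * form_tens (eps1 i) (eps1 j) \<xi> \<eta>) \<xi>)
      (dual_cobracket hv_bracket (eps1 p) \<xi>)"
  proof (rule termwise_sumI[where A = "\<lambda>_. (\<lambda>k. (k, p + 1 - k)) ` ?K"])
    fix \<eta>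
    have "dual_cobracket hv_bracket (eps1 p) \<xi> \<eta> =
        (\<Sum>k\<in>?K. of_int (p + 1 - k - k) * (Poly_Mapping.lookup (fst \<xi>) k * Poly_Mapping.lookup (fst \<eta>) (p + 1 - k)))"
      by (simp add: dual_cobracket_def hv_bracket_def lookup_minus lookup_mult_finite[of ?K "fst \<xi>"]
          lookup_deriv_mult_finite[of ?K "fst \<xi>"] lookup_laurent_deriv sum_subtractf[symmetric] algebra_simps)
    then show "dual_cobracket hv_bracket (eps1 p) \<xi> \<eta> = (\<Sum>ij\<in>(\<lambda>k. (k, p + 1 - k)) ` ?K.
        (case ij of (i, j) \<Rightarrow> \<lambda>\<xi> \<eta>. of_int (j - i) * form_tens (eps1 i) (eps1 j) \<xi> \<eta>) \<xi> \<eta>)"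
      by (subst sum.reindex) (auto simp: inj_on_def form_tens_def)
  next
    fix \<eta> ij assume "ij \<in> {(i, j). i + j = p + 1}" "ij \<notin> (\<lambda>k. (k, p + 1 - k)) ` ?K"
    then obtain i j where ij: "ij = (i, j)" "j = p + 1 - i" "i \<notin> ?K" by (cases ij) force
    then show "(case ij of (i, j) \<Rightarrow> \<lambda>\<xi> \<eta>. of_int (j - i) * form_tens (eps1 i) (eps1 j) \<xi> \<eta>) \<xi> \<eta> = 0"
      by (simp add: form_tens_def in_keys_iff)
  qed auto
qed

lemma dual_cobracket_eps2:
  "termwise_sum2 {(i, j). i + j = p + 1}
    (\<lambda>(i, j) \<xi> \<eta>. of_int j * form_tens (eps1 i) (eps2 j) \<xi> \<eta> - of_int i * form_tens (eps2 i) (eps1 j) \<xi> \<eta>)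
    (dual_cobracket hv_bracket (eps2 p))"
  unfolding termwise_sum2_def
proof
  fix \<xi> :: "'a hv"
  let ?K = "Poly_Mapping.keys (fst \<xi>) \<union> Poly_Mapping.keys (snd \<xi>)"
  let ?t = "\<lambda>ij. (case ij of (i, j) \<Rightarrow> \<lambda>\<xi> \<eta>. of_int j * form_tens (eps1 i) (eps2 j) \<xi> \<eta>
    - of_int i * form_tens (eps2 i) (eps1 j) \<xi> \<eta>) \<xi>"
  show "termwise_sum {(i, j). i + j = p + 1} ?t (dual_cobracket hv_bracket (eps2 p) \<xi>)"
  proof (rule termwise_sumI[where A = "\<lambda>_. (\<lambda>k. (k, p + 1 - k)) ` ?K"])
    fix \<eta>
    have "dual_cobracket hv_bracket (eps2 p) \<xi> \<eta> =
        (\<Sum>k\<in>?K. of_int (p + 1 - k) * (Poly_Mapping.lookup (fst \<xi>) k * Poly_Mapping.lookup (snd \<eta>) (p + 1 - k))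
          - of_int k * (Poly_Mapping.lookup (snd \<xi>) k * Poly_Mapping.lookup (fst \<eta>) (p + 1 - k)))"
      by (simp add: dual_cobracket_def hv_bracket_def lookup_minus lookup_mult_finite[of ?K "fst \<xi>"]
          lookup_deriv_mult_finite[of ?K "snd \<xi>"] lookup_laurent_deriv sum_subtractf sum.distrib algebra_simps)
    then show "dual_cobracket hv_bracket (eps2 p) \<xi> \<eta> = (\<Sum>ij\<in>(\<lambda>k. (k, p + 1 - k)) ` ?K. ?t ij \<eta>)"
      by (subst sum.reindex) (auto simp: inj_on_def form_tens_def)
  next
    fix \<eta> ij assume "ij \<in> {(i, j). i + j = p + 1}" "ij \<notin> (\<lambda>k. (k, p + 1 - k)) ` ?K"
    then obtain i j where ij: "ij = (i, j)" "j = p + 1 - i" "i \<notin> ?K" by (cases ij) force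
    then show "?t ij \<eta> = 0" by (simp add: form_tens_def in_keys_iff)
  qed auto
qed

lemma eps_bracket_xpow:
  "eps1 j (hv_bracket \<xi> (xpow l, 0)) = of_int (2 * l - j - 1) * eps1 (j - l + 1) \<xi>"
  "eps2 j (hv_bracket \<xi> (xpow l, 0)) = of_int (l - 1 - j) * eps2 (j - l + 1) \<xi>"
proof -
  have single: "Poly_Mapping.lookup (q * Poly_Mapping.single k c) n = c * Poly_Mapping.lookup q (n - k)"
    for q :: "'a laurent" and k c n
    using lookup_single_mult[of k c q n] by (simp add: mult.commute)
  have index: "j - (l - 1) = j - l + 1" by simp
  show "eps1 j (hv_bracket \<xi> (xpow l, 0)) = of_int (2 * l - j - 1) * eps1 (j - l + 1) \<xi>"
    by (simp add: hv_bracket_def xpow_def lookup_minus lookup_single_mult single lookup_laurent_deriv index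
        left_diff_distrib distrib_right)
  show "eps2 j (hv_bracket \<xi> (xpow l, 0)) = of_int (l - 1 - j) * eps2 (j - l + 1) \<xi>"
    by (simp add: hv_bracket_def xpow_def lookup_minus lookup_single_mult single lookup_laurent_deriv index
        left_diff_distrib distrib_right)
qed

lemma eps_xpow:
  "eps1 i (xpow l, v) = (if i = l then 1 else 0)" "eps2 i (u, 0) = 0"
  by (simp_all add: xpow_def lookup_single when_def)

text \<open>The shape of the bracket dual to the coboundary of \<open>a \<otimes> b - b \<otimes> a\<close>, with \<open>X \<xi> = [\<xi>, a]\<close> and
  \<open>Y \<xi> = [\<xi>, b]\<close>.\<close>

lemma formally_bilinear_dual_bracket:
  assumes "\<And>f h \<xi>. f \<in> dual_space hv_scale \<Longrightarrow> h \<in> dual_space hv_scale \<Longrightarrow>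
    B f h \<xi> = f (X \<xi>) * h b + f a * h (Y \<xi>) - f (Y \<xi>) * h a - f b * h (X \<xi>)"
  shows "formally_bilinear B"
  unfolding formally_bilinear_def
proof (intro ballI)
  fix f h :: "'a hv \<Rightarrow> 'a" assume f: "f \<in> dual_space hv_scale" and h: "h \<in> dual_space hv_scale"
  define A where "A = (\<lambda>\<xi>. {p. eps p (X \<xi>) \<noteq> 0} \<union> {p. eps p (Y \<xi>) \<noteq> 0} \<union> {p. eps p a \<noteq> 0} \<union> {p. eps p b \<noteq> 0})"
  have fin: "finite (A \<xi>)" for \<xi> by (simp add: A_def finite_eps_support)
  have off: "eps p (X \<xi>) = 0" "eps p (Y \<xi>) = 0" "eps p a = 0" "eps p b = 0" if "p \<notin> A \<xi>" for p \<xi>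
    using that by (simp_all add: A_def)
  show "termwise_sum UNIV (\<lambda>(p, q) \<xi>. f (hv_basis p) * h (hv_basis q) * B (eps p) (eps q) \<xi>) (B f h)"
  proof (rule termwise_sumI[where A = "\<lambda>\<xi>. A \<xi> \<times> A \<xi>"])
    fix \<xi>
    have split: "g v * k w = (\<Sum>(p, q)\<in>A \<xi> \<times> A \<xi>. g (hv_basis p) * k (hv_basis q) * (eps p v * eps q w))"
      if "g \<in> dual_space hv_scale" "k \<in> dual_space hv_scale" "v \<in> {X \<xi>, Y \<xi>, a, b}" "w \<in> {X \<xi>, Y \<xi>, a, b}"
      for g k :: "'a hv \<Rightarrow> 'a" and v w
    proof -
      have "{p. eps p v \<noteq> 0} \<subseteq> A \<xi>" "{p. eps p w \<noteq> 0} \<subseteq> A \<xi>" using that(3,4) by (auto simp: A_def)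
      then have "g v * k w = (\<Sum>p\<in>A \<xi>. g (hv_basis p) * eps p v) * (\<Sum>q\<in>A \<xi>. k (hv_basis q) * eps q w)"
        by (intro arg_cong2[of _ _ _ _ "(*)"] hv_dual_expand that(1,2) fin)
      also have "\<dots> = (\<Sum>(p, q)\<in>A \<xi> \<times> A \<xi>. g (hv_basis p) * k (hv_basis q) * (eps p v * eps q w))"
        by (simp add: sum_product sum.cartesian_product ac_simps)
      finally show ?thesis .
    qed
    have "B f h \<xi> = f (X \<xi>) * h b + f a * h (Y \<xi>) - f (Y \<xi>) * h a - f b * h (X \<xi>)"
      by (rule assms[OF f h])
    also have "\<dots> = (\<Sum>(p, q)\<in>A \<xi> \<times> A \<xi>. f (hv_basis p) * h (hv_basis q) *
        (eps p (X \<xi>) * eps q b + eps p a * eps q (Y \<xi>) - eps p (Y \<xi>) * eps q a - eps p b * eps q (X \<xi>)))"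
      unfolding split[OF f h, of "X \<xi>" b, simplified] split[OF f h, of a "Y \<xi>", simplified]
        split[OF f h, of "Y \<xi>" a, simplified] split[OF f h, of b "X \<xi>", simplified]
      by (simp only: case_prod_unfold distrib_left right_diff_distrib sum.distrib sum_subtractf)
    also have "\<dots> = (\<Sum>(p, q)\<in>A \<xi> \<times> A \<xi>. f (hv_basis p) * h (hv_basis q) * B (eps p) (eps q) \<xi>)"
      by (simp only: assms[OF eps_dual eps_dual])
    finally show "B f h \<xi> = (\<Sum>pq\<in>A \<xi> \<times> A \<xi>.
        (case pq of (p, q) \<Rightarrow> \<lambda>\<xi>. f (hv_basis p) * h (hv_basis q) * B (eps p) (eps q) \<xi>) \<xi>)"
      by (simp add: case_prod_unfold)
  next
    fix \<xi> pq assume "pq \<notin> A \<xi> \<times> A \<xi>"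
    then obtain p q where "pq = (p, q)" "p \<notin> A \<xi> \<or> q \<notin> A \<xi>" by (cases pq) auto
    then show "(case pq of (p, q) \<Rightarrow> \<lambda>\<xi>. f (hv_basis p) * h (hv_basis q) * B (eps p) (eps q) \<xi>) \<xi> = 0"
      using off[of p \<xi>] off[of q \<xi>] by (auto simp: assms[OF eps_dual eps_dual])
  qed (auto simp: fin)
qed

section \<open>The dual Lie bialgebra\<close>

theorem theorem3p5:
  fixes m :: int
    and r :: "('k::{alg_closed_field, field_char_0}, 'k hv) tensor"
    and \<delta> :: "'k hv \<Rightarrow> ('k, 'k hv) tensor"
  assumes "m \<noteq> 0"
    and "r = hv_tens (xpow 1, 0) (xpow (m + 1), 0) - hv_tens (xpow (m + 1), 0) (xpow 1, 0)"
    and "\<delta> = coboundary hv_scale UNIV hv_bracket r"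
  shows
    "coboundary_triangular hv_scale UNIV hv_bracket r \<and>
     maximal_good (hv_scale :: 'k \<Rightarrow> 'k hv \<Rightarrow> 'k hv) hv_bracket = laurent_circ_sum \<and>
     (\<exists>D. dual_lie_bialgebra hv_scale hv_bracket \<delta> laurent_circ_sum (dual_bracket \<delta>) D) \<and>
     (\<forall>C :: ('k hv \<Rightarrow> 'k) \<Rightarrow> 'k hv \<Rightarrow> 'k hv \<Rightarrow> 'k.
        (formally_linear C \<and>
         (\<forall>p. termwise_sum2 {(i, j). i + j = p + 1}
           (\<lambda>(i, j) \<xi> \<eta>. of_int (j - i) * form_tens (eps1 i) (eps1 j) \<xi> \<eta>)
           (C (eps1 p))) \<and>
         (\<forall>p. termwise_sum2 {(i, j). i + j = p + 1}
           (\<lambda>(i, j) \<xi> \<eta>. of_int j * form_tens (eps1 i) (eps2 j) \<xi> \<eta>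
                          - of_int i * form_tens (eps2 i) (eps1 j) \<xi> \<eta>)
           (C (eps2 p))))
        \<longleftrightarrow> (\<forall>f\<in>dual_space hv_scale. C f = dual_cobracket hv_bracket f)) \<and>
     (\<forall>B :: ('k hv \<Rightarrow> 'k) \<Rightarrow> ('k hv \<Rightarrow> 'k) \<Rightarrow> ('k hv \<Rightarrow> 'k).
        (formally_bilinear B \<and>
         (\<forall>f\<in>dual_space hv_scale. \<forall>h\<in>dual_space hv_scale. B f h = - B h f) \<and>
         (\<forall>j. j \<noteq> 1 \<longrightarrow>
           B (eps1 1) (eps1 j) = fun_scale (of_int (2 * m - j + 1)) (eps1 (j - m))) \<and>
         (\<forall>j. j \<noteq> 1 \<and> j \<noteq> m + 1 \<longrightarrow>
           B (eps1 (m + 1)) (eps1 j) = fun_scale (of_int (j - 1)) (eps1 j)) \<and>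
         (\<forall>i j. i \<notin> {1, m + 1} \<and> j \<notin> {1, m + 1} \<longrightarrow> B (eps1 i) (eps1 j) = 0) \<and>
         (\<forall>j. B (eps1 1) (eps2 j) = fun_scale (of_int (m - j)) (eps2 (j - m))) \<and>
         (\<forall>j. B (eps1 (m + 1)) (eps2 j) = fun_scale (of_int j) (eps2 j)) \<and>
         (\<forall>i j. i \<notin> {1, m + 1} \<longrightarrow> B (eps1 i) (eps2 j) = 0) \<and>
         (\<forall>i j. B (eps2 i) (eps2 j) = 0))
        \<longleftrightarrow> (\<forall>f\<in>dual_space hv_scale. \<forall>h\<in>dual_space hv_scale. B f h = dual_bracket \<delta> f h))"
    (is "?T \<and> ?M \<and> ?E \<and> (\<forall>C. ?co C \<longleftrightarrow> ?coeq C) \<and> (\<forall>B. ?br B \<longleftrightarrow> ?breq B)")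
proof -
  let ?U = "laurent_circ_sum :: ('k hv \<Rightarrow> 'k) set"
  have ab: "hv_bracket (xpow 1, 0) (xpow (m + 1), 0) = hv_scale (of_int m) ((xpow (m + 1), 0) :: 'k hv)"
    using hv_bracket_LL[of 0 m] by simp
  have T: ?T by (rule wedge_coboundary_triangular[OF hv_lie_algebra ab assms(2)])
  then have bialg: "lie_bialgebra_on hv_scale UNIV hv_bracket \<delta>"
    by (simp add: coboundary_triangular_def assms(3))
  have "dual_bracket \<delta> f h \<in> ?U" if "f \<in> ?U" "h \<in> ?U" for f h
    unfolding assms(2,3) by (rule wedge_dual_bracket_closed[OF hv_lie_algebra ab good_laurent_circ_sum that])
  then have E: ?E
    using dual_lie_bialgebra_exists[OF bialg good_laurent_circ_sum]
    unfolding dual_lie_bialgebra_def maximal_good_hv by blast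

  have co: "?co C \<longleftrightarrow> ?coeq C" for C :: "('k hv \<Rightarrow> 'k) \<Rightarrow> 'k hv \<Rightarrow> 'k hv \<Rightarrow> 'k"
  proof
    assume C: "?co C"
    have "C (eps a) = dual_cobracket hv_bracket (eps a)" for a
    proof (cases a)
      case (Inl p)
      show ?thesis unfolding Inl
        by (rule termwise_sum2_unique[OF _ dual_cobracket_eps1]) (use C in blast)
    next
      case (Inr p)
      show ?thesis unfolding Inr
        by (rule termwise_sum2_unique[OF _ dual_cobracket_eps2]) (use C in blast)
    qed
    then show "?coeq C" using C formally_linear_unique[OF _ formally_linear_dual_cobracket] by blast
  next
    assume C: "?coeq C"
    then have "formally_linear C \<longleftrightarrow> formally_linear (dual_cobracket hv_bracket :: ('k hv \<Rightarrow> 'k) \<Rightarrow> _)"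
      by (simp add: formally_linear_def eps_dual)
    moreover have "C (eps a) = dual_cobracket hv_bracket (eps a)" for a using C eps_dual by blast
    ultimately show "?co C"
      by (simp only: dual_cobracket_eps1 dual_cobracket_eps2 formally_linear_dual_cobracket simp_thms)
  qed

  let ?\<beta> = "dual_bracket \<delta>"
  have \<beta>: "?\<beta> f h \<xi> = f (hv_bracket \<xi> (xpow 1, 0)) * h (xpow (m + 1), 0)
      + f (xpow 1, 0) * h (hv_bracket \<xi> (xpow (m + 1), 0))
      - f (hv_bracket \<xi> (xpow (m + 1), 0)) * h (xpow 1, 0)
      - f (xpow (m + 1), 0) * h (hv_bracket \<xi> (xpow 1, 0))"
    if "f \<in> dual_space hv_scale" "h \<in> dual_space hv_scale" for f h \<xi>
    unfolding assms(3) by (rule wedge_dual_bracket[OF hv_lie_algebra ab assms(2) that])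
  have \<beta>_formal: "formally_bilinear ?\<beta>" by (rule formally_bilinear_dual_bracket[OF \<beta>])
  have \<beta>_skew: "?\<beta> f h = - ?\<beta> h f" if "f \<in> dual_space hv_scale" "h \<in> dual_space hv_scale" for f h
    by (rule ext) (simp add: \<beta> that)
  have \<beta>_br: "?br ?\<beta>"
  proof (intro conjI allI impI ballI)
    show "formally_bilinear ?\<beta>" by (rule \<beta>_formal)
    show "?\<beta> f h = - ?\<beta> h f" if "f \<in> dual_space hv_scale" "h \<in> dual_space hv_scale" for f h
      using that by (rule \<beta>_skew)
  qed (use \<open>m \<noteq> 0\<close> in \<open>auto simp: \<beta>[OF eps_dual eps_dual] eps_bracket_xpow eps_xpow fun_eq_iff
      algebra_simps simp del: eps.simps\<close>)
  \<comment> \<open>The values on dual basis vectors, without formal bilinearity and skew-symmetry, which would loop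
    as rewrite rules.\<close>
  note \<beta>_table = \<beta>_br[THEN conjunct2, THEN conjunct2]
  have br: "?br B \<longleftrightarrow> ?breq B" for B :: "('k hv \<Rightarrow> 'k) \<Rightarrow> ('k hv \<Rightarrow> 'k) \<Rightarrow> 'k hv \<Rightarrow> 'k"
  proof
    assume B: "?br B"
    note B_formal = conjunct1[OF B] and B_skew = conjunct1[OF conjunct2[OF B]]
      and B_table = conjunct2[OF conjunct2[OF B]]
    have eq: "B (eps a) (eps b) = ?\<beta> (eps a) (eps b)" for a b
    proof -
      have skew: "B (eps a) (eps b) = - B (eps b) (eps a)" "?\<beta> (eps a) (eps b) = - ?\<beta> (eps b) (eps a)" for a b
        by (rule B_skew[rule_format, OF eps_dual eps_dual], rule \<beta>_skew[OF eps_dual eps_dual])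
      have diag: "B (eps a) (eps a) = ?\<beta> (eps a) (eps a)" for a
      proof
        fix \<xi>
        have "B (eps a) (eps a) \<xi> = 0" "?\<beta> (eps a) (eps a) \<xi> = 0"
          using fun_cong[OF skew(1), of a a \<xi>] fun_cong[OF skew(2), of a a \<xi>] by simp_all
        then show "B (eps a) (eps a) \<xi> = ?\<beta> (eps a) (eps a) \<xi>" by simp
      qed
      have listed: "B (eps1 i) (eps1 j) = ?\<beta> (eps1 i) (eps1 j)"
        if "i = 1 \<and> j \<noteq> 1 \<or> i = m + 1 \<and> j \<notin> {1, m + 1} \<or> i \<notin> {1, m + 1} \<and> j \<notin> {1, m + 1}" for i j
        using that B_table \<beta>_table by (elim disjE) (simp_all del: eps.simps)
      have mixed: "B (eps1 i) (eps2 j) = ?\<beta> (eps1 i) (eps2 j)" for i j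
        using B_table \<beta>_table by (cases "i = 1"; cases "i = m + 1") (simp_all del: eps.simps)
      show ?thesis
      proof (cases a; cases b)
        fix i j assume a: "a = Inl i" and b: "b = Inl j"
        consider "i = j" | "i = 1 \<and> j \<noteq> 1 \<or> i = m + 1 \<and> j \<notin> {1, m + 1} \<or> i \<notin> {1, m + 1} \<and> j \<notin> {1, m + 1}"
          | "j = 1 \<and> i \<noteq> 1 \<or> j = m + 1 \<and> i \<notin> {1, m + 1}" by auto
        then show ?thesis
        proof cases
          case 1
          then show ?thesis unfolding a b by (simp only: diag)
        next
          case 2
          then show ?thesis unfolding a b by (rule listed)
        next
          case 3
          then have "B (eps1 j) (eps1 i) = ?\<beta> (eps1 j) (eps1 i)" by (intro listed) auto
          then show ?thesis unfolding a b skew[of "Inl i" "Inl j"] by simp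
        qed
      next
        fix i j assume a: "a = Inl i" and b: "b = Inr j"
        show ?thesis unfolding a b by (rule mixed)
      next
        fix i j assume a: "a = Inr i" and b: "b = Inl j"
        show ?thesis unfolding a b skew[of "Inr i" "Inl j"] mixed ..
      next
        fix i j assume a: "a = Inr i" and b: "b = Inr j"
        show ?thesis unfolding a b using B_table \<beta>_table by (simp del: eps.simps)
      qed
    qed
    show "?breq B"
      by (intro ballI formally_bilinear_unique[OF B_formal \<beta>_formal eq])
  next
    assume B: "?breq B"
    have eq: "B (eps a) (eps b) = ?\<beta> (eps a) (eps b)" for a b using B eps_dual by blast
    have B_\<beta>: "B f h = ?\<beta> f h" if "f \<in> dual_space hv_scale" "h \<in> dual_space hv_scale" for f h
      using B that by blast
    have "formally_bilinear B"
      unfolding formally_bilinear_def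
    proof (intro ballI)
      fix f h :: "'k hv \<Rightarrow> 'k" assume fh: "f \<in> dual_space hv_scale" "h \<in> dual_space hv_scale"
      show "termwise_sum UNIV (\<lambda>(a, b) \<xi>. f (hv_basis a) * h (hv_basis b) * B (eps a) (eps b) \<xi>) (B f h)"
        unfolding eq B_\<beta>[OF fh] using \<beta>_formal fh unfolding formally_bilinear_def by blast
    qed
    moreover have "\<forall>f\<in>dual_space hv_scale. \<forall>h\<in>dual_space hv_scale. B f h = - B h f"
    proof (intro ballI)
      fix f h :: "'k hv \<Rightarrow> 'k" assume fh: "f \<in> dual_space hv_scale" "h \<in> dual_space hv_scale"
      show "B f h = - B h f" unfolding B_\<beta>[OF fh] B_\<beta>[OF fh(2,1)] by (rule \<beta>_skew[OF fh])
    qed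
    ultimately show "?br B"
      by (rule conjI[OF _ conjI]) (unfold eq, rule \<beta>_table)
  qed
  show ?thesis using T maximal_good_hv E co br by blast
qed

end
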